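(* Let $p\ge 2$ and $n\ge 2$ be integers, let $\zeta_1,\dots,\zeta_p\in\mathbb{C}$ (not necessarily distinct) and $a_1,\dots,a_p>0$, and let $Q_2,Q_1\in\mathbb{C}[z]$ be the polynomials determined by $Q_2(z)=\prod_{l=1}^{p}(z-\zeta_l)$ and $\frac{Q_1(z)}{Q_2(z)}=\sum_{l=1}^{p}\frac{a_l}{z-\zeta_l}$. Suppose that $S,V\in\mathbb{C}[z]$ with $\deg S=n$ and $\deg V=p-2$ satisfy $$Q_2(z)S''(z)+Q_1(z)S'(z)+V(z)S(z)=0 .$$ Let $s_1,\dots,s_n$ and $v_1,\dots,v_{p-2}$ be the zeros of $S$ and $V$, respectively, listed with multiplicity, and put $\alpha=n-1+\sum_{l=1}^{p}a_l$. Then for every convex function $f:\mathbb{C}\to\mathbb{R}$ $$\sum_{i=1}^{p-2}f(v_i)+\left[1-\left(1-\frac1n\right)\left(1-\frac1\alpha\right)\right]\sum_{j=1}^{n}f(s_j)\le\sum_{l=1}^{p}\left(1-\frac{a_l}{\alpha}\right)f(\zeta_l),\qquad( * )$$ and if equality occurs in $( * )$ for some strictly convex function $f$ then the zeros of $Q_2$ are collinear. Equivalently to the validity of $( * )$ for all convex $f$, one has the weighted majorization relation $$\big((v_1,\dots,v_{p-2},s_1,\dots,s_n),\,\mathbf{a}\vee\mathbf{b}\big)\prec\big((\zeta_1,\dots,\zeta_p),\,\mathbf{c}\big),$$ where $$\mathbf{a}=\frac{\alpha}{(p-1)\alpha+n-1}\mathbf{1}_{p-2},\qquad \mathbf{b}=\frac{\alpha+n-1}{n[(p-1)\alpha+n-1]}\mathbf{1}_n,$$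 $$\mathbf{c}=\left(\frac{\alpha-a_1}{(p-1)\alpha+n-1},\dots,\frac{\alpha-a_p}{(p-1)\alpha+n-1}\right).$$ That is, there exists a row stochastic $(n+p-2)\times p$ matrix $R$ such that $$(v_1,\dots,v_{p-2},s_1,\dots,s_n)^T=R\,(\zeta_1,\dots,\zeta_p)^T\quad\text{and}\quad \mathbf{c}=(\mathbf{a}\vee\mathbf{b})R .$$
   Context: $\mathbf{1}_m=(1,\dots,1)\in\mathbb{R}^m$ (the empty vector if $m=0$), and $\vee$ denotes concatenation of vectors: $(x_1,\dots,x_m)\vee(y_1,\dots,y_n)=(x_1,\dots,x_m,y_1,\dots,y_n)$. A matrix is row stochastic if its entries are nonnegative and every row sums to $1$. Weighted majorization: for $X\in\mathbb{C}^m$, $Y\in\mathbb{C}^n$ and weight (row) vectors $\mathbf{a}\in[0,1]^m$, $\mathbf{b}\in[0,1]^n$ each with entries summing to $1$, one writes $(X,\mathbf{a})\prec(Y,\mathbf{b})$ if there is a row stochastic $m\times n$ matrix $R$ with $X^T=RY^T$ and $\mathbf{b}=\mathbf{a}R$. *)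

theory Defs
  imports "HOL-Analysis.Analysis" "Jordan_Normal_Form.Matrix"
begin

text \<open>Vectors and matrices of variable size are those of \<open>Jordan_Normal_Form\<close>; they are indexed
  from \<open>0\<close>. The rival \<open>$\<close> of the finite Cartesian products is switched off.\<close>

unbundle no vec_syntax

definition ones_vec :: "nat \<Rightarrow> real vec" where
  "ones_vec m = Matrix.vec m (\<lambda>_. 1)"

definition row_stochastic :: "real mat \<Rightarrow> bool" where
  "row_stochastic R \<longleftrightarrow>
     (\<forall>i<dim_row R. (\<forall>j<dim_col R. 0 \<le> R $$ (i, j)) \<and> (\<Sum>j<dim_col R. R $$ (i, j)) = 1)"

definition weight_vec :: "real vec \<Rightarrow> bool" where
  "weight_vec w \<longleftrightarrow> (\<forall>i<dim_vec w. w $ i \<in> {0..1}) \<and> (\<Sum>i<dim_vec w. w $ i) = 1"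

text \<open>The vectors of \<open>Jordan_Normal_Form\<close> are column vectors, so the relation \<open>b = a R\<close> between row
  vectors is stated in transposed form.\<close>

definition weighted_majorized ::
  "complex vec \<Rightarrow> real vec \<Rightarrow> complex vec \<Rightarrow> real vec \<Rightarrow> bool" where
  "weighted_majorized X a Y b \<longleftrightarrow>
     dim_vec a = dim_vec X \<and> dim_vec b = dim_vec Y \<and> weight_vec a \<and> weight_vec b \<and>
     (\<exists>R \<in> carrier_mat (dim_vec X) (dim_vec Y).
        row_stochastic R \<and>
        X = map_mat complex_of_real R *\<^sub>v Y \<and>
        b = transpose_mat R *\<^sub>v a)"

definition strictly_convex_on :: "'a::real_vector set \<Rightarrow> ('a \<Rightarrow> real) \<Rightarrow> bool" where
  "strictly_convex_on A f \<longleftrightarrow> convex A \<and>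
     (\<forall>x\<in>A. \<forall>y\<in>A. \<forall>t. x \<noteq> y \<and> 0 < t \<and> t < 1 \<longrightarrow>
        f ((1 - t) *\<^sub>R x + t *\<^sub>R y) < (1 - t) * f x + t * f y)"

end

theory Submission
  imports Defs "Jordan_Normal_Form.Schur_Decomposition"
begin

text \<open>Let \<open>c\<close> be positive weights with sum \<open>1\<close> on nodes \<open>z\<close>, and let \<open>w\<close> be the zeros of
  \<open>\<Sum>l. c\<^sub>l / (t - z\<^sub>l)\<close> times \<open>\<Prod>l. (t - z\<^sub>l)\<close>. With the unit vector \<open>u = (sqrt c\<^sub>l)\<close>, the \<open>w\<close> are the
  eigenvalues of the compression of \<open>diag z\<close> to the orthogonal complement of \<open>u\<close>. A unitary Schur
  triangularization of the compression gives orthonormal vectors \<open>y\<^sub>i\<close>, orthogonal to \<open>u\<close>, with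
  \<open>w\<^sub>i = \<Sum>l. \<bar>y\<^sub>i(l)\<bar>\<^sup>2 z\<^sub>l\<close>, so \<open>w\<close> is majorized by \<open>z\<close> with weights \<open>1 - c\<^sub>l\<close>.

  The differential equation says that the zeros of \<open>V S\<close> arise in this way from the nodes
  \<open>\<zeta>\<^sub>l\<close> with weights \<open>a\<^sub>l / \<alpha>\<close> and the zeros of \<open>S'\<close> with weights \<open>1 / \<alpha>\<close>; the zeros of \<open>S'\<close> in turn
  arise from the zeros of \<open>S\<close> with weights \<open>1 / n\<close>. Substituting the second relation into the first
  expresses the zeros of \<open>S\<close> partly by themselves, with total weight
  \<open>(1 - 1/n) (1 - 1/\<alpha>) < 1\<close>, and a fixed-point argument removes this self-reference.\<close>

subsection \<open>Unitary matrices and Schur triangularization\<close>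

definition cadjoint :: "complex mat \<Rightarrow> complex mat" where
  "cadjoint U = map_mat cnj (transpose_mat U)"

text \<open>One of the two identities suffices for a square matrix; \<open>unitary_matD\<close>
  recovers the other order.\<close>

definition unitary_mat :: "nat \<Rightarrow> complex mat \<Rightarrow> bool" where
  "unitary_mat n U \<longleftrightarrow> U \<in> carrier_mat n n \<and> cadjoint U * U = 1\<^sub>m n"

lemma cadjoint_carrier [simp]: "U \<in> carrier_mat m n \<Longrightarrow> cadjoint U \<in> carrier_mat n m"
  by (simp add: cadjoint_def)

lemma index_cadjoint [simp]:
  "i < dim_col U \<Longrightarrow> j < dim_row U \<Longrightarrow> cadjoint U $$ (i, j) = cnj (U $$ (j, i))"
  "dim_row (cadjoint U) = dim_col U" "dim_col (cadjoint U) = dim_row U"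
  by (simp_all add: cadjoint_def)

lemma index_mult_mat_sum:
  "A \<in> carrier_mat n m \<Longrightarrow> B \<in> carrier_mat m k \<Longrightarrow> i < n \<Longrightarrow> j < k \<Longrightarrow>
    (A * B) $$ (i, j) = (\<Sum>l<m. A $$ (i, l) * B $$ (l, j))"
  by (auto simp: scalar_prod_def lessThan_atLeast0 intro!: sum.cong)

lemma conjugate_carrier:
  assumes "W \<in> carrier_mat n n" "A \<in> carrier_mat n n"
  shows "cadjoint W * A * W \<in> carrier_mat n n"
proof (rule mult_carrier_mat)
  show "cadjoint W * A \<in> carrier_mat n n" by (rule mult_carrier_mat[OF cadjoint_carrier]) (fact assms)+
qed (fact assms)

lemma cadjoint_mult:
  assumes "A \<in> carrier_mat n m" "B \<in> carrier_mat m k"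
  shows "cadjoint (A * B) = cadjoint B * cadjoint A"
proof (rule eq_matI, goal_cases)
  case (1 i j)
  then have ij: "i < k" "j < n" using assms by auto
  have "cadjoint (A * B) $$ (i, j) = cnj ((A * B) $$ (j, i))"
    using ij assms by simp
  also have "\<dots> = (\<Sum>l<m. cadjoint B $$ (i, l) * cadjoint A $$ (l, j))"
    using assms ij by (simp add: index_mult_mat_sum mult.commute del: index_mult_mat)
  also have "\<dots> = (cadjoint B * cadjoint A) $$ (i, j)"
    using assms ij by (subst index_mult_mat_sum) auto
  finally show ?case .
qed (use assms in auto)

lemma unitary_matD:
  assumes "unitary_mat n U"
  shows "U \<in> carrier_mat n n" "cadjoint U \<in> carrier_mat n n"
    "cadjoint U * U = 1\<^sub>m n" "U * cadjoint U = 1\<^sub>m n"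
proof -
  show *: "U \<in> carrier_mat n n" "cadjoint U \<in> carrier_mat n n" "cadjoint U * U = 1\<^sub>m n"
    using assms by (auto simp: unitary_mat_def)
  then show "U * cadjoint U = 1\<^sub>m n"
    using mat_mult_left_right_inverse by blast
qed

lemma unitary_mat_mult:
  assumes "unitary_mat n U" "unitary_mat n V"
  shows "unitary_mat n (U * V)"
proof -
  note U = unitary_matD[OF assms(1)] and V = unitary_matD[OF assms(2)]
  have "cadjoint (U * V) * (U * V) = cadjoint V * (cadjoint U * (U * V))"
    unfolding cadjoint_mult[OF U(1) V(1)]
    by (rule assoc_mult_mat) (use U V in auto)
  also have "cadjoint U * (U * V) = cadjoint U * U * V"
    by (rule assoc_mult_mat[symmetric]) (use U V in auto)
  finally have "cadjoint (U * V) * (U * V) = 1\<^sub>m n" using U V by simp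
  with U V show ?thesis by (auto simp: unitary_mat_def)
qed

lemma cmod_square_cnj: "(complex_of_real (cmod x))\<^sup>2 = x * cnj x"
  using complex_norm_square[of x] by simp

text \<open>Read off the diagonal of \<open>U * cadjoint U\<close>. Together with
  \<open>unitary_mat_col\<close> this makes the squared moduli of a unitary matrix doubly
  stochastic, which is the source of the couplings below.\<close>

lemma unitary_mat_row:
  assumes "unitary_mat n U" "l < n"
  shows "(\<Sum>i<n. (cmod (U $$ (l, i)))\<^sup>2) = 1"
proof -
  note U = unitary_matD[OF assms(1)]
  have "complex_of_real (\<Sum>i<n. (cmod (U $$ (l, i)))\<^sup>2) = (U * cadjoint U) $$ (l, l)"
    using U assms(2) by (subst index_mult_mat_sum) (auto simp: cmod_square_cnj)
  also have "\<dots> = 1" using U assms(2) by simp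
  finally show ?thesis by (simp only: of_real_eq_1_iff)
qed

lemma unitary_mat_col:
  assumes "unitary_mat n U" "i < n"
  shows "(\<Sum>l<n. (cmod (U $$ (l, i)))\<^sup>2) = 1"
proof -
  note U = unitary_matD[OF assms(1)]
  have "complex_of_real (\<Sum>l<n. (cmod (U $$ (l, i)))\<^sup>2) = (cadjoint U * U) $$ (i, i)"
    using U assms(2)
    by (subst index_mult_mat_sum) (auto simp: cmod_square_cnj mult.commute)
  also have "\<dots> = 1" using U assms(2) by simp
  finally show ?thesis by (simp only: of_real_eq_1_iff)
qed

text \<open>Gram-Schmidt on a basis starting with \<open>v\<close> keeps \<open>v\<close> as first
  vector, and as \<open>v\<close> has norm 1 the final normalization keeps it too. The lemma is
  applied to eigenvectors and to the vector of square roots of the weights.\<close>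

lemma unitary_completion:
  fixes v :: "complex vec"
  assumes v: "v \<in> carrier_vec (Suc k)" and norm: "(\<Sum>l<Suc k. (cmod (v $ l))\<^sup>2) = 1"
  shows "\<exists>W. unitary_mat (Suc k) W \<and> col W 0 = v"
proof -
  let ?n = "Suc k"
  interpret cof_vec_space ?n "TYPE(complex)" .
  have cprod: "x \<bullet>c y = (\<Sum>l<?n. x $ l * cnj (y $ l))"
    if "x \<in> carrier_vec ?n" "y \<in> carrier_vec ?n" for x y
    using that by (auto simp: scalar_prod_def lessThan_atLeast0 intro!: sum.cong)
  have v0: "v \<noteq> 0\<^sub>v ?n"
  proof
    assume "v = 0\<^sub>v ?n"
    then have "(\<Sum>l<?n. (cmod (v $ l))\<^sup>2) = 0" by (intro sum.neutral) simp
    then show False using norm by simp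
  qed
  define b where "b = basis_completion v"
  note b = basis_completion[OF v v0, folded b_def]
  obtain vs where bv: "b = v # vs" using b by (cases b) auto
  define ws where "ws = gram_schmidt ?n b"
  have ws: "set ws \<subseteq> carrier_vec ?n" "corthogonal ws" "length ws = ?n"
    using gram_schmidt_result[OF b(2,4,5) ws_def] b(6) by auto
  have "hd ws = v"
    using gram_schmidt_hd[OF v, of vs] by (simp only: ws_def bv)
  then have hdws: "ws ! 0 = v"
    using ws(3) hd_conv_nth[of ws] by (metis length_0_conv nat.distinct(1))
  have wsc: "ws ! i \<in> carrier_vec ?n" if "i < ?n" for i
    using ws that by auto
  define N where "N i = (\<Sum>l<?n. (cmod (ws ! i $ l))\<^sup>2)" for i
  have wsN: "ws ! i \<bullet>c ws ! i = complex_of_real (N i)" if "i < ?n" for i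
    using wsc[OF that] by (simp add: cprod N_def cmod_square_cnj del: sum.lessThan_Suc)
  \<comment> \<open>\<open>corthogonal\<close> also asserts that the product of a vector with itself
    is nonzero, so the normalization is possible.\<close>
  have N: "N i > 0" if "i < ?n" for i
  proof -
    have "N i \<noteq> 0"
      using corthogonalD[OF ws(2), of i i] that ws(3) wsN[OF that] by auto
    moreover have "N i \<ge> 0" unfolding N_def by (rule sum_nonneg) simp
    ultimately show ?thesis by simp
  qed
  define W where "W = Matrix.mat ?n ?n (\<lambda>(l, i). ws ! i $ l / complex_of_real (sqrt (N i)))"
  have W: "W \<in> carrier_mat ?n ?n" by (simp add: W_def)
  have "cadjoint W * W = 1\<^sub>m ?n"
  proof (rule eq_matI, goal_cases)
    case (1 i j)
    then have ij: "i < ?n" "j < ?n" by auto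
    have "(cadjoint W * W) $$ (i, j) = (\<Sum>l<?n. cadjoint W $$ (i, l) * W $$ (l, j))"
      using ij W by (subst index_mult_mat_sum[of _ ?n ?n _ ?n]) auto
    also have "\<dots> = (\<Sum>l<?n. ws ! j $ l * cnj (ws ! i $ l)) / (complex_of_real (sqrt (N i)) * complex_of_real (sqrt (N j)))"
      unfolding sum_divide_distrib
      by (intro sum.cong) (use ij W in \<open>auto simp: W_def\<close>)
    also have "\<dots> = (ws ! j \<bullet>c ws ! i) / complex_of_real (sqrt (N i) * sqrt (N j))"
      using ij by (simp add: cprod wsc del: sum.lessThan_Suc)
    also have "\<dots> = (if i = j then 1 else 0)"
    proof (cases "i = j")
      case True
      then show ?thesis using N[OF ij(2)] wsN[OF ij(2)] by (simp flip: of_real_mult)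
    next
      case False
      then show ?thesis using corthogonalD[OF ws(2), of j i] ij ws(3) by auto
    qed
    finally show ?case using ij by simp
  qed (use W in auto)
  moreover have "col W 0 = v"
  proof (rule eq_vecI)
    fix l assume "l < dim_vec v"
    moreover have "N 0 = 1" using norm by (simp add: N_def hdws)
    ultimately show "col W 0 $ l = v $ l" using v by (simp add: W_def hdws)
  qed (use v W in auto)
  ultimately show ?thesis using W by (auto simp: unitary_mat_def)
qed

text \<open>The direct sum of the 1 x 1 identity and \<open>U\<close>. As a right factor it leaves
  column 0 alone, so a first column once chosen survives later unitary factors.\<close>

abbreviation extend_mat :: "nat \<Rightarrow> complex mat \<Rightarrow> complex mat" where
  "extend_mat k U \<equiv> four_block_mat (1\<^sub>m 1) (0\<^sub>m 1 k) (0\<^sub>m k 1) U"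

lemma cadjoint_extend_mat:
  "U \<in> carrier_mat k k \<Longrightarrow> cadjoint (extend_mat k U) = extend_mat k (cadjoint U)"
  by (rule eq_matI) auto

lemma unitary_extend_mat:
  assumes "unitary_mat k U"
  shows "unitary_mat (Suc k) (extend_mat k U)"
proof -
  note U = unitary_matD[OF assms]
  have "cadjoint (extend_mat k U) * extend_mat k U = extend_mat k (cadjoint U * U)"
    unfolding cadjoint_extend_mat[OF U(1)]
    by (subst mult_four_block_mat[of _ 1 1 _ k _ k _ _ 1 _ k]) (use U in auto)
  then show ?thesis using U four_block_carrier_mat[of "1\<^sub>m 1" 1 1 U k k]
    by (simp add: unitary_mat_def del: four_block_carrier_mat)
qed

text \<open>Block multiplication keeps the corner, conjugates the block \<open>B\<close> by
  \<open>U\<close> and changes the two remaining blocks, so only the diagonal is recorded. Both the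
  induction step of \<open>schur_diagonal\<close> and the compression in
  \<open>weighted_critical_points\<close> rest on it.\<close>

lemma conjugate_extend_mat:
  assumes U: "U \<in> carrier_mat k k" and M: "M \<in> carrier_mat (Suc k) (Suc k)"
  defines "B \<equiv> Matrix.mat k k (\<lambda>(i, j). M $$ (Suc i, Suc j))"
  defines "M' \<equiv> cadjoint (extend_mat k U) * M * extend_mat k U"
  shows "M' $$ (0, 0) = M $$ (0, 0)"
    and "i < k \<Longrightarrow> M' $$ (Suc i, Suc i) = (cadjoint U * B * U) $$ (i, i)"
proof -
  define M1 where "M1 = Matrix.mat 1 1 (\<lambda>_. M $$ (0, 0))"
  define M2 where "M2 = Matrix.mat 1 k (\<lambda>(i, j). M $$ (0, Suc j))"
  define M3 where "M3 = Matrix.mat k 1 (\<lambda>(i, j). M $$ (Suc i, 0))"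
  have c: "M1 \<in> carrier_mat 1 1" "M2 \<in> carrier_mat 1 k" "M3 \<in> carrier_mat k 1" "B \<in> carrier_mat k k"
    by (auto simp: M1_def M2_def M3_def B_def)
  have Mb: "M = four_block_mat M1 M2 M3 B"
    by (rule eq_matI) (use M in \<open>auto simp: M1_def M2_def M3_def B_def\<close>)
  have "cadjoint (extend_mat k U) * M = four_block_mat M1 M2 (cadjoint U * M3) (cadjoint U * B)"
    unfolding cadjoint_extend_mat[OF U] Mb
    by (subst mult_four_block_mat[of _ 1 1 _ k _ k _ _ 1 _ k]) (use U c in auto)
  then have M': "M' = four_block_mat M1 (M2 * U) (cadjoint U * M3) (cadjoint U * B * U)"
    unfolding M'_def
    by (simp, subst mult_four_block_mat[of _ 1 1 _ k _ k _ _ 1 _ k]) (use U c in auto)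
  show "M' $$ (0, 0) = M $$ (0, 0)"
    unfolding M' using c U by (auto simp: M1_def)
  show "M' $$ (Suc i, Suc i) = (cadjoint U * B * U) $$ (i, i)" if "i < k"
    unfolding M' using c U that by (subst index_mat_four_block) auto
qed

lemma unitary_conjugate_similar:
  assumes "unitary_mat n W" "A \<in> carrier_mat n n"
  shows "similar_mat (cadjoint W * A * W) A"
  unfolding similar_mat_def
  by (intro exI, rule similar_mat_witI[of "cadjoint W" W n])
     (use unitary_matD[OF assms(1)] assms(2) in \<open>auto intro!: mult_carrier_mat[of _ n n _ n]\<close>)

lemma unitary_conjugate_comp:
  assumes "unitary_mat n W" "unitary_mat n D" "A \<in> carrier_mat n n"
  shows "cadjoint (W * D) * A * (W * D) = cadjoint D * (cadjoint W * A * W) * D"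
proof -
  note W = unitary_matD[OF assms(1)] and D = unitary_matD[OF assms(2)]
  have "cadjoint (W * D) * A * (W * D) = cadjoint D * (cadjoint W * A) * (W * D)"
    unfolding cadjoint_mult[OF W(1) D(1)] using W D assms(3) by (subst assoc_mult_mat) auto
  also have "\<dots> = cadjoint D * (cadjoint W * A * (W * D))"
    by (rule assoc_mult_mat) (use W D assms(3) in auto)
  also have "cadjoint W * A * (W * D) = cadjoint W * A * W * D"
    by (rule assoc_mult_mat[symmetric]) (use W D assms(3) in auto)
  also have "cadjoint D * (cadjoint W * A * W * D) = cadjoint D * (cadjoint W * A * W) * D"
    by (rule assoc_mult_mat[symmetric]) (use W D assms(3) in auto)
  finally show ?thesis .
qed


text \<open>Induction by deflation: a unit eigenvector for \<open>w 0\<close> becomes the first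
  column of a unitary matrix, the conjugated matrix is block upper triangular, and its lower block
  inherits the remaining linear factors. The order of the eigenvalues is prescribed by
  \<open>w\<close>.\<close>

theorem schur_diagonal:
  fixes B :: "complex mat"
  assumes "B \<in> carrier_mat k k" and "char_poly B = (\<Prod>i<k. [:- w i, 1:])"
  shows "\<exists>U. unitary_mat k U \<and> (\<forall>i<k. (cadjoint U * B * U) $$ (i, i) = w i)"
  using assms
proof (induction k arbitrary: B w)
  case 0
  then show ?case
    by (intro exI[of _ "1\<^sub>m 0"]) (auto simp: unitary_mat_def intro!: eq_matI)
next
  case (Suc k A w)
  note A = Suc.prems(1)
  have cp: "char_poly A = [:- w 0, 1:] * (\<Prod>i<k. [:- w (Suc i), 1:])"
    using Suc.prems(2) by (simp only: prod.lessThan_Suc_shift)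
  have "eigenvalue A (w 0)" unfolding eigenvalue_root_char_poly[OF A] cp by simp
  then obtain x where x: "x \<in> carrier_vec (Suc k)" "x \<noteq> 0\<^sub>v (Suc k)" "A *\<^sub>v x = w 0 \<cdot>\<^sub>v x"
    using A by (auto simp: eigenvalue_def eigenvector_def)
  define N where "N = (\<Sum>l<Suc k. (cmod (x $ l))\<^sup>2)"
  have "N > 0"
  proof -
    have "\<exists>l<Suc k. x $ l \<noteq> 0" using x(1,2) by (metis eq_vecI carrier_vecD index_zero_vec)
    then obtain l where "l < Suc k" "x $ l \<noteq> 0" by blast
    then show ?thesis unfolding N_def by (intro sum_pos2[of _ l]) auto
  qed
  define u where "u = complex_of_real (1 / sqrt N) \<cdot>\<^sub>v x"
  have u: "u \<in> carrier_vec (Suc k)" "A *\<^sub>v u = w 0 \<cdot>\<^sub>v u"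
    using x A by (auto simp: u_def smult_smult_assoc mult.commute mult_mat_vec)
  have "(\<Sum>l<Suc k. (cmod (u $ l))\<^sup>2) = (\<Sum>l<Suc k. (cmod (x $ l))\<^sup>2 / N)"
    by (intro sum.cong) (use x \<open>N > 0\<close> in \<open>auto simp: u_def norm_mult norm_divide power_mult_distrib power_divide\<close>)
  also have "\<dots> = 1" using \<open>N > 0\<close> unfolding sum_divide_distrib[symmetric] N_def[symmetric] by simp
  finally obtain W where W: "unitary_mat (Suc k) W" "col W 0 = u"
    using unitary_completion[OF u(1)] by blast
  note Wc = unitary_matD[OF W(1)]
  define M where "M = cadjoint W * A * W"
  have M: "M \<in> carrier_mat (Suc k) (Suc k)" unfolding M_def by (rule conjugate_carrier[OF Wc(1) A])
  \<comment> \<open>Column 0 of \<open>M\<close> is \<open>cadjoint W\<close> applied to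
    \<open>A *\<^sub>v u\<close>, hence \<open>w 0\<close> times column 0 of
    \<open>cadjoint W * W\<close>, which is a standard basis vector.\<close>
  have Mcol: "M $$ (i, 0) = (if i = 0 then w 0 else 0)" if "i < Suc k" for i
  proof -
    have WA: "cadjoint W * A \<in> carrier_mat (Suc k) (Suc k)"
      by (rule mult_carrier_mat[OF Wc(2) A])
    have "col M 0 = cadjoint W * A *\<^sub>v u"
      unfolding M_def by (subst col_mult2[OF WA Wc(1)]) (simp_all add: W(2))
    also have "\<dots> = cadjoint W *\<^sub>v (A *\<^sub>v u)"
      by (rule assoc_mult_mat_vec[OF Wc(2) A u(1)])
    also have "\<dots> = w 0 \<cdot>\<^sub>v (cadjoint W *\<^sub>v u)"
      unfolding u(2) by (rule mult_mat_vec[OF Wc(2) u(1)])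
    also have "cadjoint W *\<^sub>v u = col (cadjoint W * W) 0"
      by (subst col_mult2[OF Wc(2,1)]) (simp_all add: W(2))
    finally have "col M 0 $ i = (w 0 \<cdot>\<^sub>v col (1\<^sub>m (Suc k)) 0) $ i" using Wc by simp
    then show ?thesis using M that by (auto split: if_splits)
  qed
  define B where "B = Matrix.mat k k (\<lambda>(i, j). M $$ (Suc i, Suc j))"
  define M1 where "M1 = Matrix.mat 1 1 (\<lambda>_. w 0)"
  define M2 where "M2 = Matrix.mat 1 k (\<lambda>(i, j). M $$ (0, Suc j))"
  have c: "M1 \<in> carrier_mat 1 1" "M2 \<in> carrier_mat 1 k" "B \<in> carrier_mat k k"
    by (auto simp: M1_def M2_def B_def)
  have Mb: "M = four_block_mat M1 M2 (0\<^sub>m k 1) B"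
    by (rule eq_matI) (use M Mcol in \<open>auto simp: M1_def M2_def B_def\<close>)
  have "char_poly M1 = [:- w 0, 1:]"
    by (simp add: M1_def char_poly_defs Determinant.det_def sign_def)
  moreover have "char_poly M = char_poly A"
    unfolding M_def by (rule char_poly_similar[OF unitary_conjugate_similar[OF W(1) A]])
  ultimately have "[:- w 0, 1:] * char_poly B = [:- w 0, 1:] * (\<Prod>i<k. [:- w (Suc i), 1:])"
    using char_poly_four_block_zeros_col[OF c] cp by (simp add: Mb)
  then have "char_poly B = (\<Prod>i<k. [:- w (Suc i), 1:])"
    by (metis mult_cancel_left pCons_eq_0_iff zero_neq_one)
  from Suc.IH[OF c(3) this] obtain U where U: "unitary_mat k U"
    "\<And>i. i < k \<Longrightarrow> (cadjoint U * B * U) $$ (i, i) = w (Suc i)" by auto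
  have Uc: "U \<in> carrier_mat k k" using unitary_matD[OF U(1)] by auto
  define D where "D = extend_mat k U"
  have D: "unitary_mat (Suc k) D" using unitary_extend_mat[OF U(1)] by (simp add: D_def)
  have "(cadjoint (W * D) * A * (W * D)) $$ (i, i) = w i" if "i < Suc k" for i
    unfolding unitary_conjugate_comp[OF W(1) D A]
    using conjugate_extend_mat[OF Uc M] U(2) that Mcol[of 0]
    by (cases i) (auto simp: M_def[symmetric] D_def B_def)
  then show ?case using unitary_mat_mult[OF W(1) D] by blast
qed

subsection \<open>Compressions of diagonal matrices\<close>

text \<open>Otherwise the difference would have infinitely many zeros. The identities below have
  denominators \<open>x - z l\<close> and hold only off the nodes; this turns them into identities
  of polynomials.\<close>

lemma complex_poly_eqI:
  fixes p q :: "complex poly"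
  assumes "finite F" "\<And>x. x \<notin> F \<Longrightarrow> poly p x = poly q x"
  shows "p = q"
proof (rule ccontr)
  assume "p \<noteq> q"
  then have "finite {x. poly (p - q) x = 0}" by (intro poly_roots_finite) simp
  moreover have "- F \<subseteq> {x. poly (p - q) x = 0}" using assms(2) by auto
  ultimately have "finite (- F)" using finite_subset by blast
  with assms(1) show False by (metis finite_compl infinite_UNIV_char_0)
qed

definition diag_of :: "nat \<Rightarrow> (nat \<Rightarrow> complex) \<Rightarrow> complex mat" where
  "diag_of n d = Matrix.mat n n (\<lambda>(i, j). if i = j then d i else 0)"

lemma diag_of_carrier [simp]: "diag_of n d \<in> carrier_mat n n"
  by (simp add: diag_of_def)

lemma det_diag_of: "Determinant.det (diag_of n d) = (\<Prod>l<n. d l)"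
proof -
  have "Determinant.det (diag_of n d) = prod_list (diag_mat (diag_of n d))"
    by (rule det_upper_triangular[of _ n]) (auto simp: diag_of_def)
  then show ?thesis
    by (simp add: prod_list_diag_prod diag_of_def lessThan_atLeast0)
qed

lemma conjugate_diag_of_index:
  assumes "W \<in> carrier_mat n n" "i < n" "j < n"
  shows "(cadjoint W * diag_of n d * W) $$ (i, j) = (\<Sum>l<n. cnj (W $$ (l, i)) * d l * W $$ (l, j))"
proof -
  have "(cadjoint W * diag_of n d) $$ (i, l) = cnj (W $$ (l, i)) * d l" if "l < n" for l
  proof -
    have "(cadjoint W * diag_of n d) $$ (i, l) =
      (\<Sum>m<n. cadjoint W $$ (i, m) * diag_of n d $$ (m, l))"
      using assms that by (intro index_mult_mat_sum) auto
    also have "\<dots> = (\<Sum>m<n. if m = l then cnj (W $$ (l, i)) * d l else 0)"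
      using assms that by (intro sum.cong) (auto simp: diag_of_def)
    also have "\<dots> = cnj (W $$ (l, i)) * d l" using that by simp
    finally show ?thesis .
  qed
  moreover have "cadjoint W * diag_of n d \<in> carrier_mat n n"
    using assms by (intro mult_carrier_mat[OF cadjoint_carrier diag_of_carrier])
  ultimately show ?thesis using assms by (subst index_mult_mat_sum) auto
qed

text \<open>The inner factor \<open>W * cadjoint W\<close> cancels. In particular a conjugated
  diagonal matrix is inverted by inverting the diagonal.\<close>

lemma conjugate_diag_of_mult:
  assumes "unitary_mat n W"
  shows "(cadjoint W * diag_of n d * W) * (cadjoint W * diag_of n e * W) =
    cadjoint W * diag_of n (\<lambda>l. d l * e l) * W"
proof -
  note W = unitary_matD[OF assms]
  let ?D = "diag_of n d" and ?E = "diag_of n e"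
  have DE: "?D * ?E = diag_of n (\<lambda>l. d l * e l)"
  proof (rule eq_matI, goal_cases)
    case (1 i j)
    then have ij: "i < n" "j < n" by (auto simp: diag_of_def)
    have "(?D * ?E) $$ (i, j) = (\<Sum>m<n. ?D $$ (i, m) * ?E $$ (m, j))"
      using ij by (intro index_mult_mat_sum) auto
    also have "\<dots> = (\<Sum>m<n. if m = i then d i * ?E $$ (i, j) else 0)"
      using ij by (intro sum.cong) (auto simp: diag_of_def)
    also have "\<dots> = diag_of n (\<lambda>l. d l * e l) $$ (i, j)" using ij by (simp add: diag_of_def)
    finally show ?case .
  qed (auto simp: diag_of_def)
  have c: "cadjoint W * ?D \<in> carrier_mat n n" "?E * W \<in> carrier_mat n n"
    "cadjoint W * ?E * W \<in> carrier_mat n n" "cadjoint W * ?E \<in> carrier_mat n n"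
    by (rule mult_carrier_mat[OF W(2) diag_of_carrier] mult_carrier_mat[OF diag_of_carrier W(1)]
          conjugate_carrier[OF W(1) diag_of_carrier])+
  have "(cadjoint W * ?D * W) * (cadjoint W * ?E * W) = cadjoint W * ?D * (W * (cadjoint W * ?E * W))"
    by (rule assoc_mult_mat) (use W c in auto)
  also have "W * (cadjoint W * ?E * W) = W * (cadjoint W * (?E * W))"
    by (subst assoc_mult_mat) (use W c in auto)
  also have "\<dots> = W * cadjoint W * (?E * W)"
    by (rule assoc_mult_mat[symmetric]) (use W c in auto)
  also have "\<dots> = ?E * W" unfolding W(4) by (rule left_mult_one_mat[OF c(2)])
  also have "cadjoint W * ?D * (?E * W) = cadjoint W * ?D * ?E * W"
    by (rule assoc_mult_mat[symmetric]) (use W c in auto)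
  also have "cadjoint W * ?D * ?E = cadjoint W * (?D * ?E)"
    by (rule assoc_mult_mat[OF W(2) diag_of_carrier diag_of_carrier])
  finally show ?thesis by (simp add: DE)
qed

lemma conjugate_one:
  assumes "unitary_mat n W"
  shows "cadjoint W * diag_of n (\<lambda>_. 1) * W = 1\<^sub>m n"
proof -
  note W = unitary_matD[OF assms]
  have "diag_of n (\<lambda>_. 1) = 1\<^sub>m n" by (rule eq_matI) (auto simp: diag_of_def)
  then show ?thesis using W by simp
qed

text \<open>Cramer's rule for \<open>C\<close>, the conjugate of the diagonal matrix with entries
  \<open>x - z l\<close>: its minor at (0, 0) is its determinant times the entry (0, 0) of its
  inverse \<open>G\<close>. The minor is the determinant of xI - B, and the entry of
  \<open>G\<close> is the weighted sum on the right.\<close>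

lemma char_poly_compression:
  assumes W: "unitary_mat (Suc k) W" and x: "\<And>l. l < Suc k \<Longrightarrow> x \<noteq> z l"
  defines "M \<equiv> cadjoint W * diag_of (Suc k) z * W"
  defines "B \<equiv> Matrix.mat k k (\<lambda>(i, j). M $$ (Suc i, Suc j))"
  shows "poly (char_poly B) x =
    (\<Prod>l<Suc k. x - z l) * (\<Sum>l<Suc k. of_real ((cmod (W $$ (l, 0)))\<^sup>2) / (x - z l))"
proof -
  let ?n = "Suc k"
  note Wc = unitary_matD[OF W]
  define C where "C = cadjoint W * diag_of ?n (\<lambda>l. x - z l) * W"
  define G where "G = cadjoint W * diag_of ?n (\<lambda>l. 1 / (x - z l)) * W"
  have C: "C \<in> carrier_mat ?n ?n" and G: "G \<in> carrier_mat ?n ?n"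
    unfolding C_def G_def by (intro conjugate_carrier diag_of_carrier Wc(1))+
  have "C * G = cadjoint W * diag_of ?n (\<lambda>l. (x - z l) * (1 / (x - z l))) * W"
    unfolding C_def G_def by (rule conjugate_diag_of_mult[OF W])
  also have "diag_of ?n (\<lambda>l. (x - z l) * (1 / (x - z l))) = diag_of ?n (\<lambda>_. 1)"
    by (rule eq_matI) (use x in \<open>auto simp: diag_of_def\<close>)
  finally have CG: "C * G = 1\<^sub>m ?n" by (simp add: conjugate_one[OF W])
  have "Determinant.det C = Determinant.det (cadjoint W) * Determinant.det (diag_of ?n (\<lambda>l. x - z l)) * Determinant.det W"
  proof -
    have "cadjoint W * diag_of ?n (\<lambda>l. x - z l) \<in> carrier_mat ?n ?n"
      by (rule mult_carrier_mat[OF Wc(2) diag_of_carrier])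
    from det_mult[OF this Wc(1)] show ?thesis
      unfolding C_def by (simp add: det_mult[OF Wc(2) diag_of_carrier])
  qed
  moreover have "Determinant.det (cadjoint W) * Determinant.det W = 1"
    using det_mult[OF Wc(2,1)] Wc(3) by simp
  ultimately have detC: "Determinant.det C = (\<Prod>l<?n. x - z l)"
    unfolding det_diag_of by (metis mult.assoc mult.commute mult_1)
  have "adj_mat C = adj_mat C * (C * G)" using CG adj_mat(1)[OF C] by simp
  also have "\<dots> = adj_mat C * C * G"
    by (rule assoc_mult_mat[symmetric]) (use adj_mat(1)[OF C] C G in auto)
  also have "\<dots> = Determinant.det C \<cdot>\<^sub>m G" unfolding adj_mat(3)[OF C]
    using G by (simp add: mult_smult_assoc_mat[of _ ?n ?n])
  finally have "adj_mat C $$ (0, 0) = Determinant.det C * G $$ (0, 0)" using G by simp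
  moreover have "adj_mat C $$ (0, 0) = Determinant.det (mat_delete C 0 0)"
    using C by (simp add: adj_mat_def cofactor_def)
  \<comment> \<open>\<open>char_matrix B x\<close> is B - xI, whence the minus sign. Unitarity of
    \<open>W\<close> collects the terms in \<open>x\<close> into a multiple of the identity.\<close>
  moreover have "mat_delete C 0 0 = - char_matrix B x"
  proof (rule eq_matI, goal_cases)
    case (1 i j)
    then have ij: "i < k" "j < k" by (auto simp: char_matrix_def B_def)
    have "(\<Sum>l<?n. cnj (W $$ (l, Suc i)) * 1 * W $$ (l, Suc j)) = 1\<^sub>m ?n $$ (Suc i, Suc j)"
      using conjugate_diag_of_index[OF Wc(1), of "Suc i" "Suc j" "\<lambda>_. 1"] ij
      by (simp add: conjugate_one[OF W] del: sum.lessThan_Suc)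
    moreover have "C $$ (Suc i, Suc j) = x * (\<Sum>l<?n. cnj (W $$ (l, Suc i)) * 1 * W $$ (l, Suc j)) - M $$ (Suc i, Suc j)"
      unfolding C_def M_def using ij
      by (simp add: conjugate_diag_of_index[OF Wc(1)] sum_distrib_left sum_subtractf[symmetric] algebra_simps
            del: sum.lessThan_Suc)
    ultimately show ?case using ij C
      by (simp add: mat_delete_def char_matrix_def B_def)
  qed (use C in \<open>auto simp: mat_delete_def char_matrix_def B_def\<close>)
  moreover have "G $$ (0, 0) = (\<Sum>l<?n. of_real ((cmod (W $$ (l, 0)))\<^sup>2) / (x - z l))"
    unfolding G_def
    by (subst conjugate_diag_of_index[OF Wc(1)])
       (auto simp: cmod_square_cnj mult.commute simp del: sum.lessThan_Suc)
  moreover have "B \<in> carrier_mat k k" by (simp add: B_def)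
  ultimately show ?thesis by (simp only: char_poly_matrix detC)
qed

text \<open>The coupling consists of the squared moduli of a unitary matrix \<open>Y\<close> with
  its column 0 removed. Columns of norm 1 give the row sums of \<open>R\<close>; each row of
  \<open>Y\<close> loses the weight \<open>c l\<close> with column 0, which gives the column sums
  \<open>1 - c l\<close>. For equal weights the \<open>w i\<close> are the critical points of the
  polynomial with zeros \<open>z l\<close>.\<close>

theorem weighted_critical_points:
  fixes z w :: "nat \<Rightarrow> complex" and c :: "nat \<Rightarrow> real"
  assumes c: "\<And>l. l < Suc k \<Longrightarrow> 0 \<le> c l" "(\<Sum>l<Suc k. c l) = 1"
    and w: "\<And>x. (\<And>l. l < Suc k \<Longrightarrow> x \<noteq> z l) \<Longrightarrow>
      (\<Prod>i<k. x - w i) = (\<Prod>l<Suc k. x - z l) * (\<Sum>l<Suc k. of_real (c l) / (x - z l))"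
  obtains R :: "nat \<Rightarrow> nat \<Rightarrow> real"
  where "\<And>i l. 0 \<le> R i l"
    "\<And>i. i < k \<Longrightarrow> (\<Sum>l<Suc k. R i l) = 1"
    "\<And>l. l < Suc k \<Longrightarrow> (\<Sum>i<k. R i l) = 1 - c l"
    "\<And>i. i < k \<Longrightarrow> w i = (\<Sum>l<Suc k. of_real (R i l) * z l)"
proof -
  let ?n = "Suc k"
  define u where "u = Matrix.vec ?n (\<lambda>l. complex_of_real (sqrt (c l)))"
  have u: "u \<in> carrier_vec ?n" "(\<Sum>l<?n. (cmod (u $ l))\<^sup>2) = 1"
  proof -
    have "(\<Sum>l<?n. (cmod (u $ l))\<^sup>2) = (\<Sum>l<?n. c l)"
      by (intro sum.cong) (use c(1) in \<open>auto simp: u_def\<close>)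
    then show "(\<Sum>l<?n. (cmod (u $ l))\<^sup>2) = 1" using c(2) by simp
  qed (simp add: u_def)
  obtain W where W: "unitary_mat ?n W" "col W 0 = u" using unitary_completion[OF u] by blast
  note Wc = unitary_matD[OF W(1)]
  have Wu: "(cmod (W $$ (l, 0)))\<^sup>2 = c l" if "l < ?n" for l
  proof -
    have "W $$ (l, 0) = u $ l" using that Wc(1) W(2) by (metis carrier_matD index_col zero_less_Suc)
    then show ?thesis using that c(1) by (simp add: u_def)
  qed
  define M where "M = cadjoint W * diag_of ?n z * W"
  define B where "B = Matrix.mat k k (\<lambda>(i, j). M $$ (Suc i, Suc j))"
  have M: "M \<in> carrier_mat ?n ?n"
    unfolding M_def by (intro conjugate_carrier diag_of_carrier Wc(1))
  have "char_poly B = (\<Prod>i<k. [:- w i, 1:])"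
  proof (rule complex_poly_eqI[of "z ` {..<?n}"])
    fix x assume "x \<notin> z ` {..<?n}"
    then have x: "\<And>l. l < ?n \<Longrightarrow> x \<noteq> z l" by auto
    have "(\<Sum>l<?n. of_real ((cmod (W $$ (l, 0)))\<^sup>2) / (x - z l)) = (\<Sum>l<?n. of_real (c l) / (x - z l))"
      by (intro sum.cong) (use Wu in auto)
    then have "poly (char_poly B) x = (\<Prod>i<k. x - w i)"
      using char_poly_compression[OF W(1) x] w[OF x] by (simp only: B_def M_def)
    then show "poly (char_poly B) x = poly (\<Prod>i<k. [:- w i, 1:]) x"
      by (simp add: poly_prod)
  qed simp
  from schur_diagonal[OF _ this] obtain U where U: "unitary_mat k U"
    "\<And>i. i < k \<Longrightarrow> (cadjoint U * B * U) $$ (i, i) = w i" by (auto simp: B_def)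
  note Uc = unitary_matD[OF U(1)]
  define D where "D = extend_mat k U"
  have D: "unitary_mat ?n D" using unitary_extend_mat[OF U(1)] by (simp add: D_def)
  define Y where "Y = W * D"
  have Y: "unitary_mat ?n Y" unfolding Y_def by (rule unitary_mat_mult[OF W(1) D])
  note Yc = unitary_matD[OF Y]
  \<comment> \<open>The triangularizing factor \<open>D\<close> fixes column 0, so column 0 of
    \<open>Y\<close> still carries the weights \<open>c\<close>.\<close>
  have Y0: "Y $$ (l, 0) = W $$ (l, 0)" if "l < ?n" for l
  proof -
    have "Y $$ (l, 0) = (\<Sum>m<?n. W $$ (l, m) * D $$ (m, 0))"
      unfolding Y_def by (rule index_mult_mat_sum) (use Wc unitary_matD[OF D] that in auto)
    also have "\<dots> = (\<Sum>m<?n. if m = 0 then W $$ (l, 0) else 0)"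
      by (intro sum.cong) (use Uc in \<open>auto simp: D_def\<close>)
    finally show ?thesis by simp
  qed
  \<comment> \<open>The shift to \<open>Suc i\<close> skips column 0, which holds the square roots
    of the weights.\<close>
  define R where "R i l = (cmod (Y $$ (l, Suc i)))\<^sup>2" for i l
  show ?thesis
  proof
    show "0 \<le> R i l" for i l by (simp add: R_def)
    show "(\<Sum>l<?n. R i l) = 1" if "i < k" for i
      unfolding R_def using unitary_mat_col[OF Y, of "Suc i"] that by simp
    show "(\<Sum>i<k. R i l) = 1 - c l" if "l < ?n" for l
      using unitary_mat_row[OF Y that] Y0[OF that] Wu[OF that]
      by (simp add: R_def sum.lessThan_Suc_shift del: sum.lessThan_Suc)
    show "w i = (\<Sum>l<?n. of_real (R i l) * z l)" if "i < k" for i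
    proof -
      have "cadjoint Y * diag_of ?n z * Y = cadjoint D * M * D"
        unfolding Y_def M_def by (rule unitary_conjugate_comp[OF W(1) D diag_of_carrier])
      then have "w i = (cadjoint Y * diag_of ?n z * Y) $$ (Suc i, Suc i)"
        using conjugate_extend_mat(2)[OF Uc(1) M that] U(2)[OF that]
        by (simp only: D_def B_def)
      also have "\<dots> = (\<Sum>l<?n. cnj (Y $$ (l, Suc i)) * z l * Y $$ (l, Suc i))"
        by (rule conjugate_diag_of_index) (use Yc that in auto)
      also have "\<dots> = (\<Sum>l<?n. of_real (R i l) * z l)"
        by (intro sum.cong) (auto simp: R_def cmod_square_cnj)
      finally show ?thesis .
    qed
  qed
qed

subsection \<open>Convexity and majorization\<close>

lemma strictly_convex_imp_convex_on:
  fixes f :: "'a::real_vector \<Rightarrow> real"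
  assumes "strictly_convex_on A f"
  shows "convex_on A f"
proof (rule convex_onI)
  show "convex A" using assms by (simp add: strictly_convex_on_def)
next
  fix t :: real and x y assume t: "0 < t" "t < 1" and xy: "x \<in> A" "y \<in> A"
  show "f ((1 - t) *\<^sub>R x + t *\<^sub>R y) \<le> (1 - t) * f x + t * f y"
  proof (cases "x = y")
    case True
    have "(1 - t) *\<^sub>R y + t *\<^sub>R y = y" by (simp flip: scaleR_left_distrib)
    with True show ?thesis by (simp add: algebra_simps)
  next
    case False
    then show ?thesis using assms t xy unfolding strictly_convex_on_def by (meson less_imp_le)
  qed
qed

text \<open>Split off the term \<open>m\<close>: the mean is a proper convex combination of
  \<open>z m\<close> and the mean \<open>y\<close> of the others. These two differ, since otherwise
  the mean would be \<open>z m\<close>, so strict convexity applies to the pair and ordinary Jensen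
  to \<open>y\<close>.\<close>

lemma strict_jensen:
  fixes f :: "'a::real_vector \<Rightarrow> real"
  assumes f: "strictly_convex_on UNIV f" and I: "finite I"
    and r: "\<And>l. l \<in> I \<Longrightarrow> 0 \<le> r l" "(\<Sum>l\<in>I. r l) = 1"
    and m: "m \<in> I" "0 < r m" "z m \<noteq> (\<Sum>l\<in>I. r l *\<^sub>R z l)"
  shows "f (\<Sum>l\<in>I. r l *\<^sub>R z l) < (\<Sum>l\<in>I. r l * f (z l))"
proof -
  define t where "t = r m"
  define J where "J = I - {m}"
  have J: "finite J" "\<And>l. l \<in> J \<Longrightarrow> 0 \<le> r l" using I r by (auto simp: J_def)
  have split: "(\<Sum>l\<in>I. g l) = g m + (\<Sum>l\<in>J. g l)" for g :: "'b \<Rightarrow> 'c::comm_monoid_add"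
    using I m(1) by (simp add: J_def sum.remove)
  have tJ: "(\<Sum>l\<in>J. r l) = 1 - t" using r(2) split[of r] by (simp add: t_def)
  have t: "0 < t" using m by (simp add: t_def)
  have "t \<noteq> 1"
  proof
    assume "t = 1"
    then have "\<forall>l\<in>J. r l = 0" using tJ J by (simp add: sum_nonneg_eq_0_iff)
    then have "(\<Sum>l\<in>I. r l *\<^sub>R z l) = z m" using \<open>t = 1\<close> by (simp add: split t_def)
    with m(3) show False by simp
  qed
  moreover have "0 \<le> (\<Sum>l\<in>J. r l)" using J by (simp add: sum_nonneg)
  ultimately have t1: "t < 1" using tJ by linarith
  define y where "y = (\<Sum>l\<in>J. (r l / (1 - t)) *\<^sub>R z l)"
  have "(1 - t) *\<^sub>R y = (\<Sum>l\<in>J. r l *\<^sub>R z l)"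
    using t1 by (simp add: y_def scaleR_sum_right)
  then have eq: "(\<Sum>l\<in>I. r l *\<^sub>R z l) = (1 - t) *\<^sub>R y + t *\<^sub>R z m"
    by (simp add: split t_def)
  have "y \<noteq> z m"
  proof
    assume "y = z m"
    then have "(\<Sum>l\<in>I. r l *\<^sub>R z l) = z m" using eq by (simp flip: scaleR_left_distrib)
    with m(3) show False by simp
  qed
  then have "f (\<Sum>l\<in>I. r l *\<^sub>R z l) < (1 - t) * f y + t * f (z m)"
    using f t t1 unfolding eq strictly_convex_on_def by blast
  also have "f y \<le> (\<Sum>l\<in>J. (r l / (1 - t)) * f (z l))"
  proof -
    have "J \<noteq> {}" using tJ t1 by auto
    then show ?thesis
      unfolding y_def using J t1 strictly_convex_imp_convex_on[OF f]
      by (intro convex_on_sum) (auto simp: tJ simp flip: sum_divide_distrib)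
  qed
  then have "(1 - t) * f y \<le> (1 - t) * (\<Sum>l\<in>J. (r l / (1 - t)) * f (z l))"
    using t1 by (intro mult_left_mono) auto
  also have "\<dots> = (\<Sum>l\<in>J. r l * f (z l))" using t1 by (simp add: sum_distrib_left)
  finally show ?thesis by (simp add: split t_def)
qed

lemma jensen_complex:
  fixes f :: "complex \<Rightarrow> real"
  assumes "convex_on UNIV f" "finite I" "\<And>l. l \<in> I \<Longrightarrow> 0 \<le> r l" "(\<Sum>l\<in>I. r l) = 1"
  shows "f (\<Sum>l\<in>I. of_real (r l) * z l) \<le> (\<Sum>l\<in>I. r l * f (z l))"
proof -
  have "I \<noteq> {}" using assms(4) by auto
  then show ?thesis using convex_on_sum[of I UNIV f r z] assms
    by (simp add: scaleR_conv_of_real)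
qed

text \<open>Jensen in each row, followed by an exchange of the sums. It serves for
  \<open>R1\<close>, \<open>R2\<close> and their combination \<open>T\<close> in the final
  proof.\<close>

lemma majorization_imp_convex_ineq:
  fixes f :: "complex \<Rightarrow> real" and m n :: nat
  assumes f: "convex_on UNIV f" and a: "\<And>i. i < m \<Longrightarrow> 0 \<le> a i"
    and R: "\<And>i l. i < m \<Longrightarrow> l < n \<Longrightarrow> 0 \<le> R i l" "\<And>i. i < m \<Longrightarrow> (\<Sum>l<n. R i l) = 1"
    and x: "\<And>i. i < m \<Longrightarrow> x i = (\<Sum>l<n. of_real (R i l) * z l)"
    and b: "\<And>l. l < n \<Longrightarrow> (\<Sum>i<m. a i * R i l) = b l"
  shows "(\<Sum>i<m. a i * f (x i)) \<le> (\<Sum>l<n. b l * f (z l))"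
proof -
  have "(\<Sum>i<m. a i * f (x i)) \<le> (\<Sum>i<m. a i * (\<Sum>l<n. R i l * f (z l)))"
  proof (intro sum_mono mult_left_mono)
    fix i assume "i \<in> {..<m}"
    then show "f (x i) \<le> (\<Sum>l<n. R i l * f (z l))"
      using jensen_complex[OF f, of "{..<n}" "R i" z] R x by simp
  qed (use a in auto)
  also have "\<dots> = (\<Sum>i<m. \<Sum>l<n. a i * R i l * f (z l))" by (simp add: sum_distrib_left mult.assoc)
  also have "\<dots> = (\<Sum>l<n. \<Sum>i<m. a i * R i l * f (z l))" by (rule sum.swap)
  also have "\<dots> = (\<Sum>l<n. b l * f (z l))" by (simp add: b flip: sum_distrib_right)
  finally show ?thesis .
qed

text \<open>Equality forces row \<open>i\<close> of \<open>R\<close> to be supported on the nodes equal to \<open>w i\<close>. Counting the rows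
  with \<open>w i = z 0\<close> then shows that the total weight of the nodes equal to \<open>z 0\<close> is an integer
  in \<open>(0, 1]\<close>, so it is \<open>1\<close>.\<close>

lemma strict_equality_imp_constant:
  fixes f :: "complex \<Rightarrow> real" and z w :: "nat \<Rightarrow> complex"
  assumes f: "strictly_convex_on UNIV f"
    and c: "\<And>l. l < n \<Longrightarrow> 0 < c l" "(\<Sum>l<n. c l) = 1"
    and R: "\<And>i l. 0 \<le> R i l" "\<And>i. i < k \<Longrightarrow> (\<Sum>l<n. R i l) = 1"
      "\<And>l. l < n \<Longrightarrow> (\<Sum>i<k. R i l) = 1 - c l"
      "\<And>i. i < k \<Longrightarrow> w i = (\<Sum>l<n. of_real (R i l) * z l)"
    and eq: "(\<Sum>i<k. f (w i)) = (\<Sum>l<n. (1 - c l) * f (z l))"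
    and l: "l < n"
  shows "z l = z 0"
proof -
  have supp: "z l = w i" if "i < k" "l < n" "0 < R i l" for i l
  proof (rule ccontr)
    assume ne: "z l \<noteq> w i"
    have "(\<Sum>i<k. f (w i)) < (\<Sum>i<k. \<Sum>l<n. R i l * f (z l))"
    proof (rule sum_strict_mono_ex1)
      show "\<forall>i\<in>{..<k}. f (w i) \<le> (\<Sum>l<n. R i l * f (z l))"
        using jensen_complex[OF strictly_convex_imp_convex_on[OF f], of "{..<n}" _ z] R by simp
      show "\<exists>i\<in>{..<k}. f (w i) < (\<Sum>l<n. R i l * f (z l))"
        using strict_jensen[OF f, of "{..<n}" "R i" l z] R that ne
        by (intro bexI[of _ i]) (auto simp: scaleR_conv_of_real)
    qed simp
    also have "\<dots> = (\<Sum>l<n. \<Sum>i<k. R i l * f (z l))" by (rule sum.swap)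
    also have "\<dots> = (\<Sum>l<n. (1 - c l) * f (z l))" by (simp add: R(3) flip: sum_distrib_right)
    finally show False using eq by simp
  qed
  define L where "L = {l\<in>{..<n}. z l = z 0}"
  define I where "I = {i\<in>{..<k}. w i = z 0}"
  have "real (card I) = (\<Sum>i\<in>I. \<Sum>l<n. R i l)" by (simp add: R(2) I_def)
  also have "\<dots> = (\<Sum>i\<in>I. \<Sum>l\<in>L. R i l)"
  proof (rule sum.cong[OF refl], rule sum.mono_neutral_right, goal_cases)
    case (3 i)
    show ?case
    proof
      fix l assume "l \<in> {..<n} - L"
      with 3 show "R i l = 0" using supp[of i l] R(1)[of i l] by (force simp: I_def L_def)
    qed
  qed (auto simp: L_def)
  also have "\<dots> = (\<Sum>l\<in>L. \<Sum>i\<in>I. R i l)" by (rule sum.swap)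
  also have "\<dots> = (\<Sum>l\<in>L. \<Sum>i<k. R i l)"
  proof (rule sum.cong[OF refl], rule sum.mono_neutral_left, goal_cases)
    case (3 l)
    show ?case
    proof
      fix i assume "i \<in> {..<k} - I"
      with 3 show "R i l = 0" using supp[of i l] R(1)[of i l] by (force simp: I_def L_def)
    qed
  qed (auto simp: I_def)
  also have "\<dots> = real (card L) - (\<Sum>l\<in>L. c l)" by (simp add: R(3) L_def sum_subtractf)
  finally have int: "(\<Sum>l\<in>L. c l) = real (card L) - real (card I)" by simp
  have "0 < (\<Sum>l\<in>L. c l)"
    by (rule sum_pos2[of _ 0]) (use c l in \<open>auto simp: L_def less_imp_le\<close>)
  with int have "Suc (card I) \<le> card L" by simp
  with int have "1 \<le> (\<Sum>l\<in>L. c l)" by simp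
  moreover have "(\<Sum>l<n. c l) = (\<Sum>l\<in>L. c l) + (\<Sum>l\<in>{..<n} - L. c l)"
    by (rule sum.subset_diff[of L "{..<n}", THEN trans]) (auto simp: L_def add.commute)
  ultimately have "(\<Sum>l\<in>{..<n} - L. c l) \<le> 0" using c(2) by linarith
  \<comment> \<open>\<open>L\<close> carries the whole weight, and all weights are positive, so no
    index lies outside it.\<close>
  then have "{..<n} - L = {}"
    using c(1) sum_pos[of "{..<n} - L" c] by force
  then show ?thesis using l by (auto simp: L_def)
qed

section \<open>Removing a self-reference from a coupling\<close>

lemma sum_lessThan_add:
  fixes g :: "nat \<Rightarrow> 'a::comm_monoid_add"
  shows "(\<Sum>i<q + n. g i) = (\<Sum>i<q. g i) + (\<Sum>j<n. g (q + j))"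
  by (induction n) (simp_all add: add.assoc)

lemma prod_lessThan_add:
  fixes g :: "nat \<Rightarrow> 'a::comm_monoid_mult"
  shows "(\<Prod>i<q + n. g i) = (\<Prod>i<q. g i) * (\<Prod>j<n. g (q + j))"
  by (induction n) (simp_all add: mult.assoc)

text \<open>Column sums at most \<theta> make \<open>F\<close> a contraction in the 1-norm: the norm
  of a fixed point is at most \<theta> times itself.\<close>

lemma contraction_fixpoint_unique:
  fixes d :: "nat \<Rightarrow> complex" and F :: "nat \<Rightarrow> nat \<Rightarrow> real"
  assumes F: "\<And>i j. i < n \<Longrightarrow> j < n \<Longrightarrow> 0 \<le> F i j"
    and col: "\<And>j. j < n \<Longrightarrow> (\<Sum>i<n. F i j) \<le> \<theta>" and "\<theta> < 1"
    and d: "\<And>i. i < n \<Longrightarrow> d i = (\<Sum>j<n. of_real (F i j) * d j)"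
    and i: "i < n"
  shows "d i = 0"
proof -
  have "(\<Sum>i<n. cmod (d i)) \<le> (\<Sum>i<n. \<Sum>j<n. F i j * cmod (d j))"
  proof (rule sum_mono)
    fix i assume "i \<in> {..<n}"
    then have "cmod (d i) \<le> (\<Sum>j<n. cmod (of_real (F i j) * d j))"
      using d[of i] by (metis lessThan_iff norm_sum)
    also have "\<dots> = (\<Sum>j<n. F i j * cmod (d j))"
      using F \<open>i \<in> {..<n}\<close> by (intro sum.cong) (auto simp: norm_mult)
    finally show "cmod (d i) \<le> (\<Sum>j<n. F i j * cmod (d j))" .
  qed
  also have "\<dots> = (\<Sum>j<n. (\<Sum>i<n. F i j) * cmod (d j))"
    by (subst sum.swap) (simp add: sum_distrib_right)
  also have "\<dots> \<le> (\<Sum>j<n. \<theta> * cmod (d j))"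
    by (intro sum_mono mult_right_mono) (use col in auto)
  finally have "(1 - \<theta>) * (\<Sum>i<n. cmod (d i)) \<le> 0"
    by (simp add: left_diff_distrib flip: sum_distrib_left)
  then have "(\<Sum>i<n. cmod (d i)) \<le> 0" using \<open>\<theta> < 1\<close> by (simp add: mult_le_0_iff)
  moreover have "cmod (d i) \<le> (\<Sum>i<n. cmod (d i))" using i by (intro member_le_sum) auto
  ultimately have "cmod (d i) \<le> 0" by linarith
  then show ?thesis by simp
qed

text \<open>\<open>E\<close> and \<open>F\<close> couple the points \<open>x\<close> to the nodes
  \<open>z\<close> and to the last \<open>n\<close> of the points themselves. The coupling
  \<open>T\<close> to the nodes alone solves T = E + F T, where \<open>F\<close> acts on the last
  \<open>n\<close> rows of \<open>T\<close>. It is the limit of iterates from 0, which increase and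
  have row sums at most 1.\<close>

lemma majorization_cancel:
  fixes x z :: "nat \<Rightarrow> complex" and E F :: "nat \<Rightarrow> nat \<Rightarrow> real"
  assumes E: "\<And>i l. 0 \<le> E i l" and F: "\<And>i j. 0 \<le> F i j"
    and row: "\<And>i. i < q + n \<Longrightarrow> (\<Sum>l<p. E i l) + (\<Sum>j<n. F i j) = 1"
    and colE: "\<And>l. l < p \<Longrightarrow> (\<Sum>i<q + n. E i l) = e l"
    and colF: "\<And>j. j < n \<Longrightarrow> (\<Sum>i<q + n. F i j) = \<theta>" and "\<theta> < 1"
    and x: "\<And>i. i < q + n \<Longrightarrow>
      x i = (\<Sum>l<p. of_real (E i l) * z l) + (\<Sum>j<n. of_real (F i j) * x (q + j))"
  obtains T :: "nat \<Rightarrow> nat \<Rightarrow> real" where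
    "\<And>i l. 0 \<le> T i l"
    "\<And>i. i < q + n \<Longrightarrow> (\<Sum>l<p. T i l) = 1"
    "\<And>i. i < q + n \<Longrightarrow> x i = (\<Sum>l<p. of_real (T i l) * z l)"
    "\<And>l. l < p \<Longrightarrow> (\<Sum>i<q. T i l) + (1 - \<theta>) * (\<Sum>j<n. T (q + j) l) = e l"
proof -
  define G where "G T i l = E i l + (\<Sum>j<n. F i j * T (q + j) l)" for T :: "nat \<Rightarrow> nat \<Rightarrow> real" and i l
  define S where "S m = (G ^^ m) (\<lambda>_ _. 0)" for m
  have S_Suc: "S (Suc m) i l = E i l + (\<Sum>j<n. F i j * S m (q + j) l)" for m i l
    by (simp add: S_def G_def)
  have S0: "S 0 i l = 0" for i l by (simp add: S_def)
  have S_nonneg: "0 \<le> S m i l" for m i l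
    by (induction m arbitrary: i l) (auto simp: S0 S_Suc E F intro!: add_nonneg_nonneg sum_nonneg)
  have S_mono: "S m i l \<le> S (Suc m) i l" for m i l
  proof (induction m arbitrary: i l)
    case 0
    show ?case using S_nonneg[of 1] by (simp add: S0)
  next
    case (Suc m)
    show ?case unfolding S_Suc[of "Suc m"]
      by (subst S_Suc, intro add_left_mono sum_mono mult_left_mono Suc F)
  qed
  have S_row: "(\<Sum>l<p. S m i l) \<le> 1" if "i < q + n" for m i
    using that
  proof (induction m arbitrary: i)
    case (Suc m)
    have "(\<Sum>l<p. S (Suc m) i l) = (\<Sum>l<p. E i l) + (\<Sum>j<n. F i j * (\<Sum>l<p. S m (q + j) l))"
      unfolding S_Suc sum.distrib sum_distrib_left by (intro arg_cong2[of _ _ _ _ "(+)"] sum.swap refl)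
    also have "\<dots> \<le> (\<Sum>l<p. E i l) + (\<Sum>j<n. F i j * 1)"
      using Suc.IH F by (intro add_left_mono sum_mono mult_left_mono) auto
    finally show ?case using row[OF Suc.prems] by simp
  qed (simp add: S0)
  have S_le: "S m i l \<le> 1" if "i < q + n" "l < p" for m i l
    using S_row[OF that(1), of m] member_le_sum[of l "{..<p}" "S m i"] S_nonneg that by force
  \<comment> \<open>The default 0 outside the index range makes \<open>T\<close> nonnegative at all
    indices.\<close>
  define T where "T i l = (if i < q + n \<and> l < p then lim (\<lambda>m. S m i l) else 0)" for i l
  have lim: "(\<lambda>m. S m i l) \<longlonglongrightarrow> T i l" if "i < q + n" "l < p" for i l
  proof -
    have "incseq (\<lambda>m. S m i l)" by (rule incseq_SucI) (rule S_mono)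
    then obtain L where "(\<lambda>m. S m i l) \<longlonglongrightarrow> L"
      using S_le[OF \<open>i < q + n\<close> \<open>l < p\<close>] incseq_convergent by blast
    then have "convergent (\<lambda>m. S m i l)" by (rule convergentI)
    then show ?thesis using that by (simp add: T_def convergent_LIMSEQ_iff)
  qed
  have T_nonneg: "0 \<le> T i l" for i l
    using LIMSEQ_le_const[OF lim, of i l 0] S_nonneg by (cases "i < q + n \<and> l < p") (auto simp: T_def)
  have T: "T i l = E i l + (\<Sum>j<n. F i j * T (q + j) l)" if "i < q + n" "l < p" for i l
  proof (rule LIMSEQ_unique)
    show "(\<lambda>m. S (Suc m) i l) \<longlonglongrightarrow> T i l" using lim[OF that] by (rule LIMSEQ_Suc)
    show "(\<lambda>m. S (Suc m) i l) \<longlonglongrightarrow> E i l + (\<Sum>j<n. F i j * T (q + j) l)"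
      unfolding S_Suc using that by (intro tendsto_intros lim) auto
  qed
  have colF': "(\<Sum>i<n. F (q + i) j) \<le> \<theta>" if "j < n" for j
  proof -
    have "(\<Sum>i<n. F (q + i) j) \<le> (\<Sum>i<q. F i j) + (\<Sum>i<n. F (q + i) j)"
      using F by (simp add: sum_nonneg)
    also have "\<dots> = \<theta>" using colF[OF that] by (simp add: sum_lessThan_add)
    finally show ?thesis .
  qed
  \<comment> \<open>Stated for arbitrary node values \<open>g\<close>, to be used twice: with
    \<open>x\<close> and \<open>z\<close> for the representation of the points, and with the
    constant 1 for the row sums.\<close>
  have unique: "y i = (\<Sum>l<p. of_real (T i l) * g l)"
    if y: "\<And>i. i < q + n \<Longrightarrow>
      y i = (\<Sum>l<p. of_real (E i l) * g l) + (\<Sum>j<n. of_real (F i j) * y (q + j))" and i: "i < q + n"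
    for y g :: "nat \<Rightarrow> complex" and i
  proof -
    define d where "d i = y i - (\<Sum>l<p. of_real (T i l) * g l)" for i
    have Tg: "(\<Sum>l<p. of_real (T i l) * g l) =
        (\<Sum>l<p. of_real (E i l) * g l) + (\<Sum>j<n. of_real (F i j) * (\<Sum>l<p. of_real (T (q + j) l) * g l))"
      if "i < q + n" for i
    proof -
      have "(\<Sum>l<p. of_real (T i l) * g l) = (\<Sum>l<p. of_real (E i l) * g l +
          (\<Sum>j<n. of_real (F i j) * (of_real (T (q + j) l) * g l)))"
      proof (rule sum.cong[OF refl])
        fix l assume "l \<in> {..<p}"
        then have "T i l = E i l + (\<Sum>j<n. F i j * T (q + j) l)" using that by (intro T) auto
        from arg_cong[OF this, of "\<lambda>t. of_real t * g l"]
        show "of_real (T i l) * g l = of_real (E i l) * g l +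
            (\<Sum>j<n. of_real (F i j) * (of_real (T (q + j) l) * g l))"
          by (simp only: of_real_add of_real_sum of_real_mult distrib_right sum_distrib_right mult.assoc)
      qed
      also have "\<dots> = (\<Sum>l<p. of_real (E i l) * g l) +
          (\<Sum>j<n. \<Sum>l<p. of_real (F i j) * (of_real (T (q + j) l) * g l))"
        unfolding sum.distrib by (subst sum.swap) simp
      finally show ?thesis by (simp add: sum_distrib_left)
    qed
    have d: "d i = (\<Sum>j<n. of_real (F i j) * d (q + j))" if "i < q + n" for i
      unfolding d_def Tg[OF that] y[OF that] by (simp add: algebra_simps sum_subtractf)
    \<comment> \<open>The last \<open>n\<close> rows of \<open>F\<close> form a square block to
      which the contraction applies. The equation \<open>d\<close> then carries the vanishing to all
      rows.\<close>
    have "d (q + j) = 0" if "j < n" for j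
    proof (rule contraction_fixpoint_unique[of n "\<lambda>i j. F (q + i) j" \<theta> "\<lambda>j. d (q + j)"])
      show "d (q + i) = (\<Sum>j<n. of_real (F (q + i) j) * d (q + j))" if "i < n" for i
        using that by (intro d) simp
    qed (rule F colF' \<open>\<theta> < 1\<close> that, assumption?)+
    then have "(\<Sum>j<n. of_real (F i j) * d (q + j)) = 0" by (intro sum.neutral) simp
    then have "d i = 0" by (simp only: d[OF i])
    then show ?thesis by (simp add: d_def)
  qed
  show ?thesis
  proof
    show "0 \<le> T i l" for i l by (rule T_nonneg)
    show "x i = (\<Sum>l<p. of_real (T i l) * z l)" if "i < q + n" for i
      using unique[OF x that] .
    show "(\<Sum>l<p. T i l) = 1" if "i < q + n" for i
    proof -
      have "(1::complex) = (\<Sum>l<p. of_real (T i l) * 1)"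
      proof (rule unique[OF _ that])
        fix i assume "i < q + n"
        from arg_cong[OF row[OF this], of complex_of_real]
        show "(1::complex) = (\<Sum>l<p. of_real (E i l) * 1) + (\<Sum>j<n. of_real (F i j) * 1)" by simp
      qed
      then have "complex_of_real (\<Sum>l<p. T i l) = 1" by simp
      then show ?thesis by (simp only: of_real_eq_1_iff)
    qed
    show "(\<Sum>i<q. T i l) + (1 - \<theta>) * (\<Sum>j<n. T (q + j) l) = e l" if "l < p" for l
    proof -
      \<comment> \<open>Summing the fixed-point equation over all rows returns \<theta> times the
        sum of the last \<open>n\<close> rows; moving it to the left leaves these rows with weight 1
        - \<theta>.\<close>
      have "(\<Sum>i<q + n. T i l) = (\<Sum>i<q + n. E i l) + (\<Sum>i<q + n. \<Sum>j<n. F i j * T (q + j) l)"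
        unfolding sum.distrib[symmetric] using that by (intro sum.cong[OF refl] T) auto
      also have "(\<Sum>i<q + n. \<Sum>j<n. F i j * T (q + j) l) = (\<Sum>j<n. \<theta> * T (q + j) l)"
        by (subst sum.swap) (simp add: colF flip: sum_distrib_right)
      finally have "(\<Sum>i<q. T i l) + (\<Sum>j<n. T (q + j) l) = e l + \<theta> * (\<Sum>j<n. T (q + j) l)"
        using colE[OF that] by (simp add: sum_lessThan_add sum_distrib_left)
      then show ?thesis by (simp add: algebra_simps)
    qed
  qed
qed

subsection \<open>Heine--Stieltjes polynomials\<close>

lemma coeff_prod_linear_factors:
  fixes z :: "'b \<Rightarrow> 'a::idom"
  assumes "finite M"
  shows "coeff (\<Prod>m\<in>M. [:- z m, 1:]) (card M) = 1"
proof -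
  have "degree (\<Prod>m\<in>M. [:- z m, 1:]) = card M"
    using assms by (subst degree_prod_eq_sum_degree) auto
  moreover have "lead_coeff (\<Prod>m\<in>M. [:- z m, 1:]) = 1" by (simp add: lead_coeff_prod)
  ultimately show ?thesis by simp
qed

text \<open>Compare the coefficients of degree \<open>k\<close>: the right-hand side has the sum of
  the weights there. This determines the constants in the identities for the zeros of S' and of
  \<open>V S\<close> without computing leading coefficients.\<close>

lemma weighted_sum_normalization:
  fixes z w :: "nat \<Rightarrow> complex" and c :: "nat \<Rightarrow> real"
  assumes c: "(\<Sum>l<Suc k. c l) = 1"
    and w: "\<And>x. (\<And>l. l < Suc k \<Longrightarrow> x \<noteq> z l) \<Longrightarrow>
      \<kappa> * (\<Prod>i<k. x - w i) = (\<Prod>l<Suc k. x - z l) * (\<Sum>l<Suc k. of_real (c l) / (x - z l))"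
  shows "\<kappa> = 1"
proof -
  \<comment> \<open>The right-hand side of \<open>w\<close> with denominators cleared; each summand
    omits one of \<open>Suc k\<close> linear factors and so has degree at most
    \<open>k\<close>.\<close>
  define P where
    "P = (\<Sum>l<Suc k. Polynomial.smult (complex_of_real (c l)) (\<Prod>m\<in>{..<Suc k} - {l}. [:- z m, 1:]))"
  have "P = Polynomial.smult \<kappa> (\<Prod>i<k. [:- w i, 1:])"
  proof (rule complex_poly_eqI[of "z ` {..<Suc k}"])
    fix x assume "x \<notin> z ` {..<Suc k}"
    then have x: "\<And>l. l < Suc k \<Longrightarrow> x \<noteq> z l" by auto
    have "poly P x = (\<Sum>l<Suc k. of_real (c l) * (\<Prod>m\<in>{..<Suc k} - {l}. x - z m))"
      by (simp add: P_def poly_sum poly_prod del: sum.lessThan_Suc)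
    also have "\<dots> = (\<Sum>l<Suc k. (\<Prod>l<Suc k. x - z l) * (of_real (c l) / (x - z l)))"
    proof (intro sum.cong refl)
      fix l assume l: "l \<in> {..<Suc k}"
      then show "of_real (c l) * (\<Prod>m\<in>{..<Suc k} - {l}. x - z m) =
          (\<Prod>l<Suc k. x - z l) * (of_real (c l) / (x - z l))"
        using x[of l] by (subst (2) prod.remove[of _ l]) auto
    qed
    also have "\<dots> = (\<Prod>l<Suc k. x - z l) * (\<Sum>l<Suc k. of_real (c l) / (x - z l))"
      by (simp only: sum_distrib_left)
    also have "\<dots> = \<kappa> * (\<Prod>i<k. x - w i)" using w[OF x] by simp
    finally show "poly P x = poly (Polynomial.smult \<kappa> (\<Prod>i<k. [:- w i, 1:])) x" by (simp add: poly_prod)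
  qed simp
  then have "coeff P k = \<kappa>" using coeff_prod_linear_factors[of "{..<k}" w] by simp
  moreover have "coeff P k = (\<Sum>l<Suc k. of_real (c l))"
  proof -
    have "coeff (\<Prod>m\<in>{..<Suc k} - {l}. [:- z m, 1:]) k = 1" if "l < Suc k" for l
      using coeff_prod_linear_factors[of "{..<Suc k} - {l}" z] that by simp
    then show ?thesis by (simp add: P_def coeff_sum del: sum.lessThan_Suc)
  qed
  moreover have "(\<Sum>l<Suc k. of_real (c l)) = (1::complex)"
    using arg_cong[OF c, of complex_of_real] by simp
  ultimately show ?thesis by simp
qed

text \<open>The logarithmic derivative, by the product rule and induction on the number of
  factors.\<close>

lemma poly_pderiv_linear_factors:
  fixes z :: "nat \<Rightarrow> complex"
  assumes "S = Polynomial.smult L (\<Prod>j<n. [:- z j, 1:])" "\<And>j. j < n \<Longrightarrow> x \<noteq> z j"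
  shows "poly (pderiv S) x = poly S x * (\<Sum>j<n. 1 / (x - z j))"
proof -
  have "poly (pderiv (\<Prod>j<n. [:- z j, 1:])) x = (\<Prod>j<n. x - z j) * (\<Sum>j<n. 1 / (x - z j))"
    using assms(2)
  proof (induction n)
    case (Suc n)
    have "poly (pderiv (\<Prod>j<Suc n. [:- z j, 1:])) x =
        poly (pderiv (\<Prod>j<n. [:- z j, 1:])) x * (x - z n) + (\<Prod>j<n. x - z j)"
      unfolding prod.lessThan_Suc pderiv_mult poly_add poly_mult
      by (simp add: pderiv_pCons poly_prod algebra_simps)
    also have "\<dots> = (\<Prod>j<Suc n. x - z j) * (\<Sum>j<Suc n. 1 / (x - z j))"
      using Suc by (simp add: field_simps)
    finally show ?case .
  qed simp
  then show ?thesis by (simp add: assms(1) pderiv_smult poly_prod)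
qed

lemma complex_poly_eq_prod_roots:
  fixes S :: "complex poly"
  assumes "length ws = n" "mset ws = proots S"
  shows "S = Polynomial.smult (lead_coeff S) (\<Prod>j<n. [:- (ws ! j), 1:])"
proof -
  have "(\<Prod>x\<in>#proots S. [:- x, 1:]) = (\<Prod>x\<leftarrow>ws. [:- x, 1:])"
    unfolding assms(2)[symmetric] by (metis mset_map prod_mset_prod_list)
  also have "\<dots> = (\<Prod>j<n. [:- (ws ! j), 1:])"
    using assms(1) by (simp add: prod.list_conv_set_nth lessThan_atLeast0)
  finally show ?thesis using complex_poly_decompose_multiset[of S] by simp
qed

text \<open>Divided by Q2 S', the equation reads S''/S' + Q1/Q2 = - V S / (Q2 S'). Its left side is
  the sum of the \<open>1 / (t - w m)\<close> over the zeros of S' and of the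
  \<open>a l / (t - \<zeta> l)\<close>, so \<open>weighted_critical_points\<close> gives
  \<open>R1\<close>. Applied to S'/S, the same theorem gives \<open>R2\<close>.\<close>

lemma stieltjes_couplings:
  fixes p n :: nat and \<zeta> s v :: "nat \<Rightarrow> complex" and a :: "nat \<Rightarrow> real"
    and Q1 Q2 S V :: "complex poly" and \<alpha> :: real
  assumes p: "p \<ge> 2" and n: "n \<ge> 2" and a: "\<And>l. l < p \<Longrightarrow> a l > 0"
    and Q2: "Q2 = (\<Prod>l<p. [:- \<zeta> l, 1:])"
    and Q1: "\<And>z. poly Q2 z \<noteq> 0 \<Longrightarrow>
           poly Q1 z / poly Q2 z = (\<Sum>l<p. complex_of_real (a l) / (z - \<zeta> l))"
    and deg: "degree S = n"
    and ode: "Q2 * pderiv (pderiv S) + Q1 * pderiv S + V * S = 0"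
    and S: "S = Polynomial.smult LS (\<Prod>j<n. [:- s j, 1:])"
    and V: "V = Polynomial.smult LV (\<Prod>i<p - 2. [:- v i, 1:])"
    and \<alpha>: "\<alpha> = real n - 1 + (\<Sum>l<p. a l)"
  defines "x \<equiv> \<lambda>i. if i < p - 2 then v i else s (i - (p - 2))"
    and "c \<equiv> \<lambda>l. if l < p then a l / \<alpha> else 1 / \<alpha>"
  obtains w :: "nat \<Rightarrow> complex" and R1 R2 :: "nat \<Rightarrow> nat \<Rightarrow> real" and z :: "nat \<Rightarrow> complex"
  where "\<And>l. l < p \<Longrightarrow> z l = \<zeta> l" "\<And>m. z (p + m) = w m"
    "\<And>i l. 0 \<le> R1 i l"
    "\<And>i. i < p - 2 + n \<Longrightarrow> (\<Sum>l<p + (n - 1). R1 i l) = 1"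
    "\<And>l. l < p + (n - 1) \<Longrightarrow> (\<Sum>i<p - 2 + n. R1 i l) = 1 - c l"
    "\<And>i. i < p - 2 + n \<Longrightarrow> x i = (\<Sum>l<p + (n - 1). of_real (R1 i l) * z l)"
    "\<And>m j. 0 \<le> R2 m j"
    "\<And>m. m < n - 1 \<Longrightarrow> (\<Sum>j<n. R2 m j) = 1"
    "\<And>j. j < n \<Longrightarrow> (\<Sum>m<n - 1. R2 m j) = 1 - 1 / real n"
    "\<And>m. m < n - 1 \<Longrightarrow> w m = (\<Sum>j<n. of_real (R2 m j) * s j)"
proof -
  have S0: "S \<noteq> 0" "pderiv S \<noteq> 0" using deg n by (auto simp: pderiv_eq_0_iff)
  then have LS: "LS \<noteq> 0" using S by auto
  obtain ws where ws: "mset ws = proots (pderiv S)" using ex_mset by blast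
  have lws: "length ws = n - 1"
    by (metis ws size_mset size_proots_complex degree_pderiv deg)
  define w where "w m = ws ! m" for m
  define L' where "L' = lead_coeff (pderiv S)"
  have L': "L' \<noteq> 0" using S0 by (simp add: L'_def)
  have S': "pderiv S = Polynomial.smult L' (\<Prod>m<n - 1. [:- w m, 1:])"
    unfolding L'_def w_def by (rule complex_poly_eq_prod_roots[OF lws ws])
  have polyS: "poly S t = LS * (\<Prod>j<n. t - s j)" for t by (simp add: S poly_prod)
  have polyS': "poly (pderiv S) t = L' * (\<Prod>m<n - 1. t - w m)" for t by (simp add: S' poly_prod)
  have A: "(\<Sum>l<p. a l) > 0" by (rule sum_pos2[of _ 0]) (use a p in \<open>auto simp: less_imp_le\<close>)
  have \<alpha>1: "\<alpha> > 1" using n A by (simp add: \<alpha>)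
  have n1: "Suc (n - 1) = n" using n by simp
  have id2: "(L' / (LS * of_nat n)) * (\<Prod>m<n - 1. t - w m) =
      (\<Prod>j<Suc (n - 1). t - s j) * (\<Sum>j<Suc (n - 1). of_real (1 / real n) / (t - s j))"
    if "\<And>j. j < Suc (n - 1) \<Longrightarrow> t \<noteq> s j" for t
  proof -
    have "L' * (\<Prod>m<n - 1. t - w m) = LS * (\<Prod>j<n. t - s j) * (\<Sum>j<n. 1 / (t - s j))"
      using poly_pderiv_linear_factors[OF S, of t] that n1 unfolding polyS polyS' by simp
    moreover have "(\<Sum>j<n. of_real (1 / real n) / (t - s j)) = (\<Sum>j<n. 1 / (t - s j)) / of_nat n"
      by (simp add: sum_divide_distrib mult.commute)
    ultimately show ?thesis unfolding n1 using LS n by (simp add: field_simps)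
  qed
  have sum2: "(\<Sum>j<Suc (n - 1). 1 / real n) = 1" using n by simp
  \<comment> \<open>\<open>id2\<close> identifies the zeros only up to a constant factor; the
    weights having sum 1 force this factor to be 1.\<close>
  have "L' / (LS * of_nat n) = 1"
    by (rule weighted_sum_normalization[OF sum2 id2])
  then have id2': "(\<Prod>m<n - 1. t - w m) =
      (\<Prod>j<Suc (n - 1). t - s j) * (\<Sum>j<Suc (n - 1). of_real (1 / real n) / (t - s j))"
    if "\<And>j. j < Suc (n - 1) \<Longrightarrow> t \<noteq> s j" for t
    using id2[OF that] by simp
  obtain R2 where R2: "\<And>m j. 0 \<le> R2 m j"
    "\<And>m. m < n - 1 \<Longrightarrow> (\<Sum>j<Suc (n - 1). R2 m j) = 1"
    "\<And>j. j < Suc (n - 1) \<Longrightarrow> (\<Sum>m<n - 1. R2 m j) = 1 - 1 / real n"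
    "\<And>m. m < n - 1 \<Longrightarrow> w m = (\<Sum>j<Suc (n - 1). of_real (R2 m j) * s j)"
    by (rule weighted_critical_points[OF _ sum2 id2']) auto
  define z where "z l = (if l < p then \<zeta> l else w (l - p))" for l
  \<comment> \<open>The zeros of Q2 S' are one more than those of \<open>V S\<close>, as
    \<open>weighted_critical_points\<close> requires.\<close>
  have N: "Suc (p - 2 + n) = p + (n - 1)" using p n by simp
  \<comment> \<open>\<alpha> is the total of the residues: \<open>a l\<close> at each \<zeta> and 1
    at each of the \<open>n - 1\<close> zeros of S'.\<close>
  have sum1: "(\<Sum>l<Suc (p - 2 + n). c l) = 1"
  proof -
    have "(\<Sum>l<p + (n - 1). c l) = (\<Sum>l<p. a l) / \<alpha> + real (n - 1) / \<alpha>"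
      by (simp add: sum_lessThan_add c_def sum_divide_distrib)
    also have "\<dots> = \<alpha> / \<alpha>" using n by (simp add: \<alpha> of_nat_diff add.commute flip: add_divide_distrib)
    finally show ?thesis using \<alpha>1 unfolding N by simp
  qed
  have id1: "(- LV * LS / (L' * of_real \<alpha>)) * (\<Prod>i<p - 2 + n. t - x i) =
      (\<Prod>l<Suc (p - 2 + n). t - z l) * (\<Sum>l<Suc (p - 2 + n). of_real (c l) / (t - z l))"
    if "\<And>l. l < Suc (p - 2 + n) \<Longrightarrow> t \<noteq> z l" for t
  proof -
    have t\<zeta>: "t \<noteq> \<zeta> l" if "l < p" for l
      using \<open>\<And>l. l < Suc (p - 2 + n) \<Longrightarrow> t \<noteq> z l\<close>[of l] that N by (auto simp: z_def)
    have tw: "t \<noteq> w m" if "m < n - 1" for m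
      using \<open>\<And>l. l < Suc (p - 2 + n) \<Longrightarrow> t \<noteq> z l\<close>[of "p + m"] that N by (auto simp: z_def)
    have q2: "poly Q2 t = (\<Prod>l<p. t - \<zeta> l)" by (simp add: Q2 poly_prod)
    have q20: "poly Q2 t \<noteq> 0" using t\<zeta> by (auto simp: q2)
    define W where "W = (\<Prod>m<n - 1. t - w m)"
    have W0: "W \<noteq> 0" using tw by (auto simp: W_def)
    define A1 where "A1 = (\<Sum>l<p. of_real (a l) / (t - \<zeta> l))"
    define A2 where "A2 = (\<Sum>m<n - 1. 1 / (t - w m))"
    have e1: "poly Q1 t = poly Q2 t * A1" using Q1[OF q20] q20 by (simp add: A1_def field_simps)
    have e2: "poly (pderiv (pderiv S)) t = L' * W * A2"
      using poly_pderiv_linear_factors[OF S' tw] by (simp add: polyS' W_def A2_def)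
    have "poly (Q2 * pderiv (pderiv S) + Q1 * pderiv S + V * S) t = 0" by (simp add: ode)
    then have "poly Q2 t * (L' * W * A2) + poly Q2 t * A1 * (L' * W) +
        LV * (\<Prod>i<p - 2. t - v i) * (LS * (\<Prod>j<n. t - s j)) = 0"
      by (simp add: e1 e2 polyS polyS' W_def V poly_prod mult.assoc)
    then have key: "L' * (poly Q2 t * W * (A1 + A2)) =
        - LV * LS * ((\<Prod>i<p - 2. t - v i) * (\<Prod>j<n. t - s j))"
      by (simp add: algebra_simps eq_neg_iff_add_eq_0)
    have roots: "(\<Prod>i<p - 2 + n. t - x i) = (\<Prod>i<p - 2. t - v i) * (\<Prod>j<n. t - s j)"
      by (subst prod_lessThan_add) (simp add: x_def)
    have nodes: "(\<Prod>l<Suc (p - 2 + n). t - z l) = poly Q2 t * W"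
      unfolding N by (subst prod_lessThan_add) (simp add: z_def q2 W_def)
    have weights: "(\<Sum>l<Suc (p - 2 + n). of_real (c l) / (t - z l)) = (A1 + A2) / of_real \<alpha>"
      unfolding N sum_lessThan_add
      by (simp add: z_def c_def A1_def A2_def sum_divide_distrib add_divide_distrib field_simps)
    have "poly Q2 t * W * ((A1 + A2) / of_real \<alpha>) = L' * (poly Q2 t * W * (A1 + A2)) / (L' * of_real \<alpha>)"
      using L' by simp
    then show ?thesis unfolding roots nodes weights key by simp
  qed
  have "- LV * LS / (L' * of_real \<alpha>) = 1"
    by (rule weighted_sum_normalization[OF sum1 id1])
  then have id1': "(\<Prod>i<p - 2 + n. t - x i) =
      (\<Prod>l<Suc (p - 2 + n). t - z l) * (\<Sum>l<Suc (p - 2 + n). of_real (c l) / (t - z l))"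
    if "\<And>l. l < Suc (p - 2 + n) \<Longrightarrow> t \<noteq> z l" for t
    using id1[OF that] by simp
  have c0: "0 \<le> c l" for l using a \<alpha>1 by (simp add: c_def less_imp_le)
  obtain R1 where R1: "\<And>i l. 0 \<le> R1 i l"
    "\<And>i. i < p - 2 + n \<Longrightarrow> (\<Sum>l<Suc (p - 2 + n). R1 i l) = 1"
    "\<And>l. l < Suc (p - 2 + n) \<Longrightarrow> (\<Sum>i<p - 2 + n. R1 i l) = 1 - c l"
    "\<And>i. i < p - 2 + n \<Longrightarrow> x i = (\<Sum>l<Suc (p - 2 + n). of_real (R1 i l) * z l)"
    by (rule weighted_critical_points[OF c0 sum1 id1']) auto
  show ?thesis
    by (rule that[of z w R1 R2]) (use R1[unfolded N] R2[unfolded n1] in \<open>auto simp: z_def\<close>)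
qed

section \<open>From the two couplings to the inequality and the weighted majorization\<close>

lemma complex_poly_eq_prod_roots_vec:
  fixes S :: "complex poly"
  assumes "s \<in> carrier_vec n" "mset (list_of_vec s) = proots S"
  shows "S = Polynomial.smult (lead_coeff S) (\<Prod>j<n. [:- (s $ j), 1:])"
proof -
  have "S = Polynomial.smult (lead_coeff S) (\<Prod>j<n. [:- (list_of_vec s ! j), 1:])"
    by (rule complex_poly_eq_prod_roots) (use assms in auto)
  also have "(\<Prod>j<n. [:- (list_of_vec s ! j), 1:]) = (\<Prod>j<n. [:- (s $ j), 1:])"
    by (rule prod.cong) (use assms in auto)
  finally show ?thesis .
qed

text \<open>The inequality and the majorization are both read off one matrix \<open>T\<close>,
  obtained by composing the couplings and cancelling the self-reference; their equivalence then
  holds because both sides do. The equality case goes back to the coupling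
  \<open>R1\<close>.\<close>

theorem theorem3:
  fixes p n :: nat
    and \<zeta> s v :: "complex vec"
    and a :: "real vec"
    and Q1 Q2 S V :: "complex poly"
    and \<alpha> D :: real
    and lhs rhs :: "(complex \<Rightarrow> real) \<Rightarrow> real"
  assumes "p \<ge> 2" and "n \<ge> 2"
    and "\<zeta> \<in> carrier_vec p" and "a \<in> carrier_vec p" and "\<And>l. l < p \<Longrightarrow> a $ l > 0"
    and "Q2 = (\<Prod>l<p. [:- (\<zeta> $ l), 1:])"
    and "\<And>z. poly Q2 z \<noteq> 0 \<Longrightarrow>
           poly Q1 z / poly Q2 z = (\<Sum>l<p. complex_of_real (a $ l) / (z - \<zeta> $ l))"
    and "degree S = n" and "V \<noteq> 0" and "degree V = p - 2"
    and "Q2 * pderiv (pderiv S) + Q1 * pderiv S + V * S = 0"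
    and "s \<in> carrier_vec n" and "mset (list_of_vec s) = proots S"
    and "v \<in> carrier_vec (p - 2)" and "mset (list_of_vec v) = proots V"
    and "\<alpha> = real n - 1 + (\<Sum>l<p. a $ l)"
    and "D = (real p - 1) * \<alpha> + real n - 1"
    and "lhs = (\<lambda>f. (\<Sum>i<p - 2. f (v $ i)) +
                (1 - (1 - 1 / real n) * (1 - 1 / \<alpha>)) * (\<Sum>j<n. f (s $ j)))"
    and "rhs = (\<lambda>f. \<Sum>l<p. (1 - a $ l / \<alpha>) * f (\<zeta> $ l))"
  defines "majorization \<equiv>
    weighted_majorized
      (v @\<^sub>v s)
      (((\<alpha> / D) \<cdot>\<^sub>v ones_vec (p - 2)) @\<^sub>v (((\<alpha> + real n - 1) / (real n * D)) \<cdot>\<^sub>v ones_vec n))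
      \<zeta>
      (map_vec (\<lambda>x. (\<alpha> - x) / D) a)"
  shows "(\<forall>f. convex_on UNIV f \<longrightarrow> lhs f \<le> rhs f) \<and>
         (\<forall>f. strictly_convex_on UNIV f \<and> lhs f = rhs f \<longrightarrow> collinear {z. poly Q2 z = 0}) \<and>
         majorization \<and>
         ((\<forall>f. convex_on UNIV f \<longrightarrow> lhs f \<le> rhs f) \<longleftrightarrow> majorization)"
proof -
  define x where "x i = (if i < p - 2 then v $ i else s $ (i - (p - 2)))" for i
  define c where "c l = (if l < p then a $ l / \<alpha> else 1 / \<alpha>)" for l
  \<comment> \<open>The total weight with which each zero of \<open>S\<close> refers back to the
    points; 1 - \<theta> is the coefficient of the second sum in \<open>lhs\<close>.\<close>
  define \<theta> where "\<theta> = (1 - 1 / real n) * (1 - 1 / \<alpha>)"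
  have A: "(\<Sum>l<p. a $ l) > 0"
    by (rule sum_pos2[of _ 0]) (use assms(1,5) in \<open>auto simp: less_imp_le\<close>)
  have \<alpha>1: "\<alpha> > 1" using assms(2) A by (simp add: assms(16))
  have n: "real n \<ge> 2" using assms(2) by simp
  have \<theta>: "0 < \<theta>" "\<theta> < 1"
  proof -
    have *: "0 < 1 - 1 / real n" "1 - 1 / real n < 1" "0 < 1 - 1 / \<alpha>" "1 - 1 / \<alpha> < 1"
      using n \<alpha>1 by auto
    then show "0 < \<theta>" unfolding \<theta>_def by (intro mult_pos_pos)
    have "\<theta> < 1 - 1 / \<alpha>"
      using mult_strict_right_mono[OF *(2,3)] by (simp only: \<theta>_def mult_1_left)
    with *(4) show "\<theta> < 1" by linarith
  qed
  have \<theta>': "1 - \<theta> = (\<alpha> + real n - 1) / (real n * \<alpha>)"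
    using n \<alpha>1 by (simp add: \<theta>_def field_simps)
  have D: "D = (real p - 1) * \<alpha> + real n - 1" by (rule assms(17))
  have D0: "D > 0"
  proof -
    have "0 < (real p - 1) * \<alpha>" using assms(1) \<alpha>1 by (intro mult_pos_pos) auto
    then show ?thesis using n by (simp add: D)
  qed
  obtain w R1 R2 z where zw: "\<And>l. l < p \<Longrightarrow> z l = \<zeta> $ l" "\<And>m. z (p + m) = w m"
    and R1: "\<And>i l. 0 \<le> R1 i l"
      "\<And>i. i < p - 2 + n \<Longrightarrow> (\<Sum>l<p + (n - 1). R1 i l) = 1"
      "\<And>l. l < p + (n - 1) \<Longrightarrow> (\<Sum>i<p - 2 + n. R1 i l) = 1 - c l"
      "\<And>i. i < p - 2 + n \<Longrightarrow> x i = (\<Sum>l<p + (n - 1). of_real (R1 i l) * z l)"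
    and R2: "\<And>m j. 0 \<le> R2 m j"
      "\<And>m. m < n - 1 \<Longrightarrow> (\<Sum>j<n. R2 m j) = 1"
      "\<And>j. j < n \<Longrightarrow> (\<Sum>m<n - 1. R2 m j) = 1 - 1 / real n"
      "\<And>m. m < n - 1 \<Longrightarrow> w m = (\<Sum>j<n. of_real (R2 m j) * s $ j)"
  proof (rule stieltjes_couplings[where \<zeta> = "\<lambda>l. \<zeta> $ l" and s = "\<lambda>j. s $ j" and v = "\<lambda>i. v $ i"
        and a = "\<lambda>l. a $ l", OF assms(1,2,5,6,7,8,11) complex_poly_eq_prod_roots_vec[OF assms(12,13)]
        complex_poly_eq_prod_roots_vec[OF assms(14,15)] assms(16), folded x_def c_def], goal_cases)
    case (3 w R1 R2 z)
    show ?case by (rule 3(1)[of z w R1 R2]) (fact 3(2-))+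
  qed auto
  \<comment> \<open>The part of \<open>R1\<close> on the zeros of S', composed with
    \<open>R2\<close>; the part of \<open>R1\<close> on the \<zeta> takes the role of
    \<open>E\<close>.\<close>
  define F where "F i j = (\<Sum>m<n - 1. R1 i (p + m) * R2 m j)" for i j
  have x_q: "x (p - 2 + j) = s $ j" for j by (simp add: x_def)
  obtain T where T: "\<And>i l. 0 \<le> T i l"
    "\<And>i. i < p - 2 + n \<Longrightarrow> (\<Sum>l<p. T i l) = 1"
    "\<And>i. i < p - 2 + n \<Longrightarrow> x i = (\<Sum>l<p. of_real (T i l) * \<zeta> $ l)"
    "\<And>l. l < p \<Longrightarrow> (\<Sum>i<p - 2. T i l) + (1 - \<theta>) * (\<Sum>j<n. T (p - 2 + j) l) = 1 - c l"
  proof (rule majorization_cancel[of R1 F "p - 2" n p "\<lambda>l. 1 - c l" \<theta> x "\<lambda>l. \<zeta> $ l"])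
    show "0 \<le> F i j" for i j using R1(1) R2(1) by (simp add: F_def sum_nonneg)
    show "(\<Sum>l<p. R1 i l) + (\<Sum>j<n. F i j) = 1" if "i < p - 2 + n" for i
    proof -
      have "(\<Sum>j<n. F i j) = (\<Sum>m<n - 1. R1 i (p + m) * (\<Sum>j<n. R2 m j))"
        unfolding F_def sum_distrib_left by (rule sum.swap)
      then show ?thesis using R1(2)[OF that] R2(2) by (simp add: sum_lessThan_add)
    qed
    show "(\<Sum>i<p - 2 + n. R1 i l) = 1 - c l" if "l < p" for l using R1(3)[of l] that by simp
    \<comment> \<open>The columns of \<open>R1\<close> at zeros of S' sum to 1 - 1/\<alpha>, those
      of \<open>R2\<close> to 1 - 1/n.\<close>
    show "(\<Sum>i<p - 2 + n. F i j) = \<theta>" if "j < n" for j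
    proof -
      have "(\<Sum>i<p - 2 + n. F i j) = (\<Sum>m<n - 1. (\<Sum>i<p - 2 + n. R1 i (p + m)) * R2 m j)"
        unfolding F_def sum_distrib_right by (rule sum.swap)
      also have "\<dots> = (\<Sum>m<n - 1. (1 - 1 / \<alpha>) * R2 m j)"
        using R1(3) by (intro sum.cong) (auto simp: c_def)
      finally show ?thesis using R2(3)[OF that] by (simp add: \<theta>_def flip: sum_distrib_left)
    qed
    show "x i = (\<Sum>l<p. of_real (R1 i l) * \<zeta> $ l) + (\<Sum>j<n. of_real (F i j) * x (p - 2 + j))"
      if "i < p - 2 + n" for i
    proof -
      have "(\<Sum>m<n - 1. of_real (R1 i (p + m)) * w m) =
          (\<Sum>m<n - 1. \<Sum>j<n. of_real (R1 i (p + m) * R2 m j) * s $ j)"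
        by (intro sum.cong) (auto simp: R2(4) sum_distrib_left mult.assoc)
      also have "\<dots> = (\<Sum>j<n. of_real (F i j) * x (p - 2 + j))"
        unfolding F_def x_q of_real_sum sum_distrib_right by (rule sum.swap)
      finally show ?thesis using R1(4)[OF that] zw by (simp add: sum_lessThan_add)
    qed
  qed (use R1(1) \<theta> in auto)
  have lhs: "lhs f = (\<Sum>i<p - 2. f (v $ i)) + (1 - \<theta>) * (\<Sum>j<n. f (s $ j))" for f
    by (simp add: assms(18) \<theta>_def)
  have rhs: "rhs f = (\<Sum>l<p. (1 - c l) * f (\<zeta> $ l))" for f
    by (simp add: assms(19) c_def)
  have ineq: "lhs f \<le> rhs f" if f: "convex_on UNIV f" for f
  proof -
    \<comment> \<open>The row weights for which the last property of \<open>T\<close> is a plain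
      weighted column sum.\<close>
    let ?b = "\<lambda>i. if i < p - 2 then 1 else 1 - \<theta>"
    have "(\<Sum>i<p - 2 + n. ?b i * f (x i)) \<le> (\<Sum>l<p. (1 - c l) * f (\<zeta> $ l))"
    proof (rule majorization_imp_convex_ineq[OF f, where R = T])
      show "(\<Sum>i<p - 2 + n. ?b i * T i l) = 1 - c l" if "l < p" for l
        using T(4)[OF that] by (simp add: sum_lessThan_add sum_distrib_left)
    qed (use T \<theta> in auto)
    then show ?thesis by (simp add: lhs rhs sum_lessThan_add x_def sum_distrib_left)
  qed
  \<comment> \<open>The counting in \<open>strict_equality_imp_constant\<close> is for rows of equal
    weight, so it is applied to \<open>R1\<close> and not to \<open>T\<close>. Jensen for
    \<open>R1\<close> and then for \<open>R2\<close> bounds lhs + \<theta> times the sum over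
    \<open>S\<close> by rhs plus the same term, hence equality in the theorem forces equality for
    \<open>R1\<close>.\<close>
  have collinear: "collinear {t. poly Q2 t = 0}" if f: "strictly_convex_on UNIV f" and eq: "lhs f = rhs f" for f
  proof -
    note cf = strictly_convex_imp_convex_on[OF f]
    have "(\<Sum>m<n - 1. 1 * f (w m)) \<le> (\<Sum>j<n. (1 - 1 / real n) * f (s $ j))"
      by (rule majorization_imp_convex_ineq[OF cf, where R = R2]) (use R2 in auto)
    then have "(1 - 1 / \<alpha>) * (\<Sum>m<n - 1. f (w m)) \<le> (1 - 1 / \<alpha>) * ((1 - 1 / real n) * (\<Sum>j<n. f (s $ j)))"
      using \<alpha>1 by (intro mult_left_mono) (auto simp: sum_distrib_left)
    then have le: "(1 - 1 / \<alpha>) * (\<Sum>m<n - 1. f (w m)) \<le> \<theta> * (\<Sum>j<n. f (s $ j))"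
      by (simp add: \<theta>_def mult.assoc mult.left_commute)
    have split: "(\<Sum>l<p + (n - 1). (1 - c l) * f (z l)) = rhs f + (1 - 1 / \<alpha>) * (\<Sum>m<n - 1. f (w m))"
      by (simp add: sum_lessThan_add rhs zw c_def sum_distrib_left)
    have "(\<Sum>i<p - 2 + n. 1 * f (x i)) \<le> (\<Sum>l<p + (n - 1). (1 - c l) * f (z l))"
      by (rule majorization_imp_convex_ineq[OF cf, where R = R1]) (use R1 in auto)
    moreover have "(\<Sum>i<p - 2 + n. f (x i)) = lhs f + \<theta> * (\<Sum>j<n. f (s $ j))"
      unfolding sum_lessThan_add by (simp add: x_def lhs algebra_simps)
    ultimately have eq1: "(\<Sum>i<p - 2 + n. f (x i)) = (\<Sum>l<p + (n - 1). (1 - c l) * f (z l))"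
      using le eq unfolding split by simp
    \<comment> \<open>Equality forces even more than collinearity: all zeros of \<open>Q2\<close>
      coincide.\<close>
    have "\<zeta> $ l = \<zeta> $ 0" if "l < p" for l
    proof -
      have "z l = z 0"
      proof (rule strict_equality_imp_constant[OF f _ _ R1 eq1])
        show "0 < c l" for l using assms(5) \<alpha>1 by (simp add: c_def)
        have "(\<Sum>l<p + (n - 1). c l) = (\<Sum>l<p. a $ l) / \<alpha> + real (n - 1) / \<alpha>"
          by (simp add: sum_lessThan_add c_def sum_divide_distrib)
        also have "\<dots> = \<alpha> / \<alpha>"
          using assms(2) by (simp add: assms(16) of_nat_diff add.commute flip: add_divide_distrib)
        finally show "(\<Sum>l<p + (n - 1). c l) = 1" using \<alpha>1 by simp
      qed (use that in auto)
      then show ?thesis using zw(1)[OF that] zw(1)[of 0] assms(1) by simp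
    qed
    moreover have "\<exists>l<p. t = \<zeta> $ l" if "poly Q2 t = 0" for t
      using that unfolding assms(6) poly_prod by auto
    ultimately have "t = \<zeta> $ 0" if "poly Q2 t = 0" for t
      using that by metis
    then have "{t. poly Q2 t = 0} \<subseteq> {\<zeta> $ 0}" by (simp add: subset_iff)
    then show ?thesis by (rule collinear_subset[OF collinear_sing])
  qed
  have major: majorization
  proof -
    let ?b = "((\<alpha> / D) \<cdot>\<^sub>v ones_vec (p - 2)) @\<^sub>v (((\<alpha> + real n - 1) / (real n * D)) \<cdot>\<^sub>v ones_vec n)"
    let ?c = "map_vec (\<lambda>x. (\<alpha> - x) / D) a"
    have \<zeta>c: "dim_vec \<zeta> = p" and ac: "dim_vec a = p" and xc: "dim_vec (v @\<^sub>v s) = p - 2 + n"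
      using assms(3,4,12,14) by auto
    have bc: "dim_vec ?b = p - 2 + n" by (simp add: ones_vec_def)
    have b1: "?b $ i = \<alpha> / D" if "i < p - 2" for i using that by (simp add: ones_vec_def)
    \<comment> \<open>The prescribed weights are the row weights 1 and 1 - \<theta>, both scaled by
      \<alpha>/D.\<close>
    have b2: "?b $ (p - 2 + j) = \<alpha> / D * (1 - \<theta>)" if "j < n" for j
      using that \<alpha>1 by (simp add: ones_vec_def \<theta>')
    have bpos: "0 \<le> ?b $ i" if "i < p - 2 + n" for i
      using that \<alpha>1 D0 \<theta> b1[of i] b2[of "i - (p - 2)"] by (cases "i < p - 2") auto
    \<comment> \<open>\<open>D\<close> normalizes both weight vectors: (p - 2)\<alpha> + (\<alpha> +
      n - 1) and p\<alpha> minus the sum of the \<open>a $ l\<close> are the same number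
      \<open>D\<close>.\<close>
    have bsum: "(\<Sum>i<p - 2 + n. ?b $ i) = 1"
    proof -
      have "(\<Sum>i<p - 2 + n. ?b $ i) = real (p - 2) * (\<alpha> / D) + real n * (\<alpha> / D * (1 - \<theta>))"
        using b1 b2 by (simp add: sum_lessThan_add)
      also have "\<dots> = ((real p - 2) * \<alpha> + (\<alpha> + real n - 1)) / D"
        using assms(1) n \<alpha>1 D0 by (simp add: \<theta>' of_nat_diff add_divide_distrib)
      also have "(real p - 2) * \<alpha> + (\<alpha> + real n - 1) = D" by (simp add: D algebra_simps)
      finally show ?thesis using D0 by simp
    qed
    have wb: "weight_vec ?b"
      unfolding weight_vec_def bc atLeastAtMost_iff
    proof (intro conjI allI impI)
      fix i assume "i < p - 2 + n"
      with bpos bsum show "?b $ i \<le> 1"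
        using member_le_sum[of i "{..<p - 2 + n}" "\<lambda>i. ?b $ i"] by simp
    qed (fact bpos bsum)+
    have cpos: "0 \<le> ?c $ l" if "l < p" for l
    proof -
      have "a $ l \<le> (\<Sum>l<p. a $ l)" using that assms(5) by (intro member_le_sum) (auto simp: less_imp_le)
      then have "a $ l \<le> \<alpha>" using n by (simp add: assms(16))
      then show ?thesis using that ac D0 by simp
    qed
    have csum: "(\<Sum>l<p. ?c $ l) = 1"
    proof -
      have "(\<Sum>l<p. ?c $ l) = (\<Sum>l<p. (\<alpha> - a $ l) / D)" using ac by (intro sum.cong) auto
      also have "\<dots> = (real p * \<alpha> - (\<alpha> - real n + 1)) / D"
        by (simp add: sum_subtractf assms(16) flip: sum_divide_distrib)
      also have "real p * \<alpha> - (\<alpha> - real n + 1) = D" by (simp add: D algebra_simps)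
      finally show ?thesis using D0 by simp
    qed
    have wc: "weight_vec ?c"
      unfolding weight_vec_def index_map_vec(2) ac atLeastAtMost_iff
    proof (intro conjI allI impI)
      fix l assume "l < p"
      with cpos csum show "?c $ l \<le> 1"
        using member_le_sum[of l "{..<p}" "\<lambda>l. ?c $ l"] by simp
    qed (fact cpos csum)+
    have dims: "dim_vec ?b = dim_vec (v @\<^sub>v s)" "dim_vec ?c = dim_vec \<zeta>"
      by (simp_all only: xc bc ac \<zeta>c index_map_vec)
    define R where "R = Matrix.mat (p - 2 + n) p (\<lambda>(i, l). T i l)"
    have "row_stochastic R"
      using T(1,2) by (simp add: row_stochastic_def R_def)
    moreover have "v @\<^sub>v s = map_mat complex_of_real R *\<^sub>v \<zeta>"
    proof (rule eq_vecI)
      fix i assume "i < dim_vec (map_mat complex_of_real R *\<^sub>v \<zeta>)"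
      then have i: "i < p - 2 + n" by (simp add: R_def)
      have "(map_mat complex_of_real R *\<^sub>v \<zeta>) $ i = (\<Sum>l<p. of_real (T i l) * \<zeta> $ l)"
        using i \<zeta>c by (auto simp: R_def scalar_prod_def lessThan_atLeast0 intro!: sum.cong)
      also have "\<dots> = x i" using T(3)[OF i] by simp
      also have "\<dots> = (v @\<^sub>v s) $ i" using i assms(12,14) by (simp add: x_def)
      finally show "(v @\<^sub>v s) $ i = (map_mat complex_of_real R *\<^sub>v \<zeta>) $ i" by simp
    qed (use xc in \<open>simp add: R_def\<close>)
    moreover have "?c = transpose_mat R *\<^sub>v ?b"
    proof (rule eq_vecI)
      fix l assume "l < dim_vec (transpose_mat R *\<^sub>v ?b)"
      then have l: "l < p" by (simp add: R_def)
      have "(transpose_mat R *\<^sub>v ?b) $ l = (\<Sum>i<p - 2 + n. T i l * ?b $ i)"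
        using l bc by (auto simp: R_def scalar_prod_def lessThan_atLeast0 intro!: sum.cong)
      also have "\<dots> = (\<Sum>i<p - 2. T i l * (\<alpha> / D)) + (\<Sum>j<n. T (p - 2 + j) l * (\<alpha> / D * (1 - \<theta>)))"
        using b1 b2 by (simp add: sum_lessThan_add)
      also have "\<dots> = \<alpha> / D * ((\<Sum>i<p - 2. T i l) + (1 - \<theta>) * (\<Sum>j<n. T (p - 2 + j) l))"
        unfolding sum_distrib_right[symmetric] distrib_left by (simp only: mult_ac)
      \<comment> \<open>The column property of \<open>T\<close> scaled by \<alpha>/D: here 1 -
        \<open>c l\<close> is 1 - \<open>a $ l\<close>/\<alpha>, because
        \<open>l < p\<close>.\<close>
      also have "\<dots> = ?c $ l" using T(4)[OF l] l ac \<alpha>1 by (simp add: c_def field_simps)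
      finally show "?c $ l = (transpose_mat R *\<^sub>v ?b) $ l" by simp
    qed (simp add: R_def ac)
    moreover have "R \<in> carrier_mat (dim_vec (v @\<^sub>v s)) (dim_vec \<zeta>)"
      by (simp only: xc \<zeta>c) (simp add: R_def)
    ultimately show ?thesis
      unfolding majorization_def weighted_majorized_def
      by (intro conjI bexI[of _ R] wb wc dims)
  qed
  show ?thesis
  proof (intro conjI allI impI iffI)
    show "lhs f \<le> rhs f" if "convex_on UNIV f" for f using that by (rule ineq)
    show "lhs f \<le> rhs f" if "convex_on UNIV f" for f using that by (rule ineq)
    show "collinear {t. poly Q2 t = 0}" if "strictly_convex_on UNIV f \<and> lhs f = rhs f" for f
      using that by (elim conjE) (rule collinear)
    show majorization majorization by (fact major)+
  qed
qed

end
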